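(* Let $q\equiv 3\pmod 4$ be a prime power and let $k_1,\dots,k_n$ be distinct odd positive integers. Let $A_0(t)\in\mathbb{F}_q[t]$ be nonzero with $t^{k_i}-1\mid A_0(t)$ for all $i$, and write $A_0(t)=(t^{k_i}-1)B_i(t)$. For $P(t)=\sum_j p_jt^j\in\mathbb{F}_q[t]$ put $P(\mathbf{F}):=\sum_j p_jt^{q^j}$, and let $A(t)=A_0(\mathbf{F})$, $\beta_i(t)=B_i(\mathbf{F})$. Then the points $$Q_i=\left(\beta_i^{\frac{q^{k_i}-1}{2}},\ \beta_i^{\frac{q^{k_i}-3}{4}}\right),\qquad i=1,\dots,n,$$ lie on the elliptic curve $E_A:\ A(t)y^2=x^3-x$ and are $\mathbb{Z}$-linearly independent in the Mordell–Weil group $E_A(\mathbb{F}_q(t))$. *)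

theory Defs
  imports
    "HOL-Algebra.FiniteProduct"
    "HOL-Library.Cardinality"
    "HOL-Computational_Algebra.Polynomial_Factorial"
begin

text \<open>
  For \<open>P = \<Sum>\<^sub>j p\<^sub>j t\<^sup>j\<close> over the finite field with \<open>q = CARD('a)\<close> elements, this is
  \<open>P(F) = \<Sum>\<^sub>j p\<^sub>j t^(q^j)\<close>.
\<close>

definition frob_poly :: "'a::{field,finite} poly \<Rightarrow> 'a poly" where
  "frob_poly P = (\<Sum>j\<le>degree P. monom (coeff P j) (CARD('a) ^ j))"

datatype 'k point = Infinity | Affine 'k 'k

text \<open>
  The curve \<open>E\<^sub>a: a y\<^sup>2 = x\<^sup>3 - x\<close> over a field of characteristic different from 2, with \<open>a \<noteq> 0\<close>
  (these two conditions are not built into the definitions).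
\<close>

definition curve_points :: "'k::field \<Rightarrow> 'k point set" where
  "curve_points a = insert Infinity {Affine x y | x y. a * y ^ 2 = x ^ 3 - x}"

text \<open>
  Chord-tangent addition.  A line of slope \<open>l\<close> through two points of \<open>E\<^sub>a\<close> meets the curve in a
  third point, and substituting the line into the equation shows that the three abscissae add up
  to \<open>a l\<^sup>2\<close>.  The tangent slope at \<open>(x, y)\<close> is \<open>(3 x\<^sup>2 - 1) / (2 a y)\<close>.  Two points of the curve
  with equal abscissa are equal or opposite, so when the last case is reached with
  \<open>x\<^sub>1 = x\<^sub>2\<close>, the two points coincide and \<open>y\<^sub>1 \<noteq> 0\<close>.
\<close>

fun point_add :: "'k::field \<Rightarrow> 'k point \<Rightarrow> 'k point \<Rightarrow> 'k point" where
  "point_add a Infinity Q = Q"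
| "point_add a P Infinity = P"
| "point_add a (Affine x1 y1) (Affine x2 y2) =
     (if x1 = x2 \<and> y1 = - y2 then Infinity
      else let l = (if x1 = x2 then (3 * x1 ^ 2 - 1) / (2 * a * y1)
                    else (y2 - y1) / (x2 - x1));
               x3 = a * l ^ 2 - x1 - x2
           in Affine x3 (- (y1 + l * (x3 - x1))))"

text \<open>The Mordell-Weil group of \<open>E\<^sub>a\<close>, written multiplicatively as is usual for \<^typ>\<open>'a monoid\<close>.\<close>

definition mordell_weil :: "'k::field \<Rightarrow> 'k point monoid" where
  "mordell_weil a = \<lparr>carrier = curve_points a, monoid.mult = point_add a, one = Infinity\<rparr>"

text \<open>\<open>\<int>\<close>-linear independence of a finite family in a commutative group in multiplicative notation.\<close>

definition int_lin_indep :: "('g, 'm) monoid_scheme \<Rightarrow> 'i set \<Rightarrow> ('i \<Rightarrow> 'g) \<Rightarrow> bool" where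
  "int_lin_indep G I Q \<longleftrightarrow>
     (\<forall>c :: 'i \<Rightarrow> int. (\<Otimes>\<^bsub>G\<^esub>i\<in>I. Q i [^]\<^bsub>G\<^esub> c i) = \<one>\<^bsub>G\<^esub> \<longrightarrow> (\<forall>i\<in>I. c i = 0))"

end

theory Submission
  imports "HOL-Algebra.Ideal_Product" "HOL-Algebra.Algebraic_Closure_Type" Defs
begin

text \<open>
  A non-trivial relation between the \<open>Q\<^sub>i\<close> is excluded by a partial \<open>2\<close>-descent.  Up to squares,
  \<open>x(Q\<^sub>i)\<close> is \<open>\<beta>\<^sub>i\<close>, because \<open>(q^k\<^sub>i - 1)/2\<close> is odd, and the descent map \<open>P \<mapsto> A x(P)\<close> is a
  homomorphism to \<open>K\<^sup>* / (K\<^sup>*)\<^sup>2\<close>; only the parity of its order of vanishing at points \<open>\<theta>\<close> of the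
  algebraic closure is needed.  The polynomial \<open>D(F)\<close> vanishes to odd order at \<open>\<theta>\<close> or not at all,
  according to whether \<open>D\<close> annihilates \<open>\<theta>\<close> in the \<open>F\<^sub>q[t]\<close>-module structure given by Frobenius.
  If \<open>\<theta>\<close> has annihilator \<open>A\<^sub>0\<close>, no \<open>\<beta>\<^sub>i\<close> vanishes at \<open>\<theta>\<close>; if it has annihilator \<open>B\<^sub>i\<close>, where
  \<open>k\<^sub>i\<close> is minimal among the indices with odd coefficient, \<open>\<beta>\<^sub>i\<close> is the only one of these to vanish
  at \<open>\<theta>\<close>.  Hence all coefficients of a relation up to \<open>2\<close>-torsion are even.  As no non-zero
  \<open>2\<close>-torsion point is a double, the relation can be halved forever.

  Associativity of the chord-tangent law comes from the ideal class group of the coordinate ring: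
  three collinear points have a principal product of ideals, and points with equivalent
  ideals are equal.
\<close>

section \<open>Chords and tangents\<close>

text \<open>The line \<open>y = l x + \<nu>\<close> through the two points (the tangent if they
  coincide) meets the curve where
  \<open>x^3 - a l^2 x^2 - (1 + 2 a l \<nu>) x - a \<nu>^2 = 0\<close>. The last three conclusions
  are Vieta's formulas for this cubic; they let chords and tangents be treated alike.\<close>

lemma point_add_line:
  fixes a :: "'k::field"
  assumes "(2::'k) \<noteq> 0" "a \<noteq> 0"
    and P: "a * y1 ^ 2 = x1 ^ 3 - x1" and Q: "a * y2 ^ 2 = x2 ^ 3 - x2"
    and "\<not> (x1 = x2 \<and> y1 = - y2)"
  obtains l \<nu> x3 where "point_add a (Affine x1 y1) (Affine x2 y2) = Affine x3 (- (l * x3 + \<nu>))"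
    "y1 = l * x1 + \<nu>" "y2 = l * x2 + \<nu>" "x1 + x2 + x3 = a * l ^ 2"
    "x1 * x2 + x1 * x3 + x2 * x3 = - 1 - 2 * a * l * \<nu>" "x1 * x2 * x3 = a * \<nu> ^ 2"
proof -
  define l where "l = (if x1 = x2 then (3 * x1 ^ 2 - 1) / (2 * a * y1) else (y2 - y1) / (x2 - x1))"
  define \<nu> where "\<nu> = y1 - l * x1"
  define x3 where "x3 = a * l ^ 2 - x1 - x2"
  have y1: "y1 = l * x1 + \<nu>"
    by (simp add: \<nu>_def)
  have s1: "x1 + x2 + x3 = a * l ^ 2"
    by (simp add: x3_def)
  have "point_add a (Affine x1 y1) (Affine x2 y2) = Affine x3 (- (y1 + l * (x3 - x1)))"
    unfolding point_add.simps if_not_P[OF assms(5)] Let_def l_def[symmetric] x3_def ..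
  also have "y1 + l * (x3 - x1) = l * x3 + \<nu>"
    by (simp add: \<nu>_def algebra_simps)
  finally have add: "point_add a (Affine x1 y1) (Affine x2 y2) = Affine x3 (- (l * x3 + \<nu>))" .
  have y2: "y2 = l * x2 + \<nu>" and
    s2: "x1 * x2 + x1 * x3 + x2 * x3 = - 1 - 2 * a * l * \<nu>"
  proof -
    have "y2 = l * x2 + \<nu> \<and> x1 * x2 + x1 * x3 + x2 * x3 = - 1 - 2 * a * l * \<nu>"
    proof (cases "x1 = x2")
      case False
      have l: "l * (x2 - x1) = y2 - y1"
        using False by (simp add: l_def)
      have y2: "y2 = l * x2 + \<nu>"
        using l by (simp add: \<nu>_def algebra_simps)
      have x3: "x3 = a * l ^ 2 - x1 - x2"
        by (fact x3_def)
      \<comment> \<open>The difference of the two curve equations is \<open>x2 - x1\<close> times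
        the relation sought.\<close>
      have "(x2 - x1) * (x1 * x2 + x1 * x3 + x2 * x3 - (- 1 - 2 * a * l * \<nu>)) =
          (a * y2 ^ 2 - (x2 ^ 3 - x2)) - (a * y1 ^ 2 - (x1 ^ 3 - x1))"
        unfolding y1 y2 x3 by (simp add: algebra_simps power2_eq_square power3_eq_cube)
      then have "(x2 - x1) * (x1 * x2 + x1 * x3 + x2 * x3 - (- 1 - 2 * a * l * \<nu>)) = 0"
        using P Q by simp
      then show ?thesis
        using False y2 by simp
    next
      case True
      have "a * y1 ^ 2 = a * y2 ^ 2"
        using P Q True by simp
      then have y12: "y2 = y1"
        using assms(2,5) True by (auto simp: power2_eq_iff)
      then have "y1 + y1 \<noteq> 0"
        using assms(5) True by (auto simp: eq_neg_iff_add_eq_0)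
      then have "2 * a * y1 \<noteq> 0"
        using assms(1,2) by auto
      then have l: "l * (2 * a * y1) = 3 * x1 ^ 2 - 1"
        using True by (simp add: l_def)
      have "x1 * x2 + x1 * x3 + x2 * x3 = - 1 - 2 * a * l * \<nu>"
        using l unfolding True[symmetric] y1 x3_def
        by (simp add: algebra_simps power2_eq_square)
      then show ?thesis
        using y1 y12 True by simp
    qed
    then show "y2 = l * x2 + \<nu>" "x1 * x2 + x1 * x3 + x2 * x3 = - 1 - 2 * a * l * \<nu>"
      by auto
  qed
  \<comment> \<open>\<open>x1\<close> is a root of the monic cubic with roots \<open>x1\<close>,
    \<open>x2\<close>, \<open>x3\<close>, which expresses the product through the other two
    symmetric functions.\<close>
  have "x1 * x2 * x3 = x1 ^ 3 - (x1 + x2 + x3) * x1 ^ 2 + (x1 * x2 + x1 * x3 + x2 * x3) * x1"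
    by (simp add: algebra_simps power2_eq_square power3_eq_cube)
  also have "\<dots> = (x1 ^ 3 - x1) - a * l ^ 2 * x1 ^ 2 - 2 * a * l * \<nu> * x1"
    unfolding s1 s2 by (simp add: algebra_simps)
  also have "\<dots> = a * \<nu> ^ 2"
    unfolding P[symmetric] y1 by (simp add: algebra_simps power2_eq_square)
  finally have "x1 * x2 * x3 = a * \<nu> ^ 2" .
  then show thesis
    by (intro that[OF add y1 y2 s1 s2])
qed

section \<open>Negation, commutativity and closure\<close>

fun point_neg :: "'k::field point \<Rightarrow> 'k point" where
  "point_neg Infinity = Infinity"
| "point_neg (Affine x y) = Affine x (- y)"

lemma Infinity_in_curve_points [simp]: "Infinity \<in> curve_points a"
  by (simp add: curve_points_def)

lemma Affine_in_curve_points [simp]: "Affine x y \<in> curve_points a \<longleftrightarrow> a * y ^ 2 = x ^ 3 - x"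
  by (simp add: curve_points_def)

lemma point_neg_in_curve_points [simp]: "point_neg P \<in> curve_points a \<longleftrightarrow> P \<in> curve_points a"
  by (cases P) auto

lemma point_neg_point_neg [simp]: "point_neg (point_neg P) = P"
  by (cases P) auto

lemma point_add_Infinity_right [simp]: "point_add a P Infinity = P"
  by (cases P) auto

lemma point_add_neg_left: "point_add a (point_neg P) P = Infinity"
  by (cases P) auto

lemma point_add_commute: "point_add a P Q = point_add a Q P"
  if "P \<in> curve_points a" "Q \<in> curve_points a" "a \<noteq> 0"
proof (cases P; cases Q)
  fix x1 y1 x2 y2 assume [simp]: "P = Affine x1 y1" "Q = Affine x2 y2"
  show ?thesis
  proof (cases "x1 = x2")
    case True
    then have "a * y1 ^ 2 = a * y2 ^ 2"
      using that by simp
    then have "y1 = y2 \<or> y1 = - y2"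
      using that(3) by (simp add: power2_eq_iff)
    then show ?thesis
      using True by auto
  next
    case False
    define l where "l = (y2 - y1) / (x2 - x1)"
    have l': "(y1 - y2) / (x1 - x2) = l"
      using False by (simp add: l_def divide_simps) (simp add: algebra_simps)
    have "l * (x2 - x1) = y2 - y1"
      using False by (simp add: l_def)
    then have "y2 + l * (x - x2) = y1 + l * (x - x1)" for x
      by (simp add: algebra_simps)
    then show ?thesis
      using False by (simp add: Let_def l' flip: l_def) (simp add: algebra_simps)
  qed
qed auto

lemma point_add_closed:
  fixes a :: "'k::field"
  assumes "(2::'k) \<noteq> 0" "a \<noteq> 0" and P: "P \<in> curve_points a" and Q: "Q \<in> curve_points a"
  shows "point_add a P Q \<in> curve_points a"
proof (cases P; cases Q)
  fix x1 y1 x2 y2 assume [simp]: "P = Affine x1 y1" "Q = Affine x2 y2"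
  show ?thesis
  proof (cases "x1 = x2 \<and> y1 = - y2")
    case False
    from P Q have "a * y1 ^ 2 = x1 ^ 3 - x1" "a * y2 ^ 2 = x2 ^ 3 - x2"
      by simp_all
    from point_add_line[OF assms(1,2) this False] show ?thesis
    proof cases
      case (1 l \<nu> x3)
      have "a * (- (l * x3 + \<nu>)) ^ 2 = a * l ^ 2 * x3 ^ 2 - (- 1 - 2 * a * l * \<nu>) * x3 - x3 + a * \<nu> ^ 2"
        by (simp add: algebra_simps power2_eq_square)
      also have "\<dots> = x3 ^ 3 - x3"
        unfolding 1(4-6)[symmetric] by (simp add: algebra_simps power2_eq_square power3_eq_cube)
      finally have "a * (- (l * x3 + \<nu>)) ^ 2 = x3 ^ 3 - x3" .
      with 1(1) show ?thesis
        by (simp del: point_add.simps)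
    qed
  qed auto
qed (use P Q in auto)

section \<open>Associativity via the ideal class group\<close>

text \<open>The pair \<open>(p, q)\<close> stands for \<open>p(x) + q(x) y\<close> in \<open>K[x, y] / (y\<^sup>2 - F(x))\<close>.\<close>

definition coord_ring :: "'k::field poly \<Rightarrow> ('k poly \<times> 'k poly) ring" where
  "coord_ring F = \<lparr>carrier = UNIV,
     monoid.mult = (\<lambda>g h. (fst g * fst h + F * snd g * snd h, fst g * snd h + snd g * fst h)),
     one = (1, 0), ring.zero = (0, 0), add = (\<lambda>g h. (fst g + fst h, snd g + snd h))\<rparr>"

lemma coord_ring_simps [simp]:
  "carrier (coord_ring F) = UNIV"
  "(p, q) \<otimes>\<^bsub>coord_ring F\<^esub> (r, s) = (p * r + F * q * s, p * s + q * r)"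
  "(p, q) \<oplus>\<^bsub>coord_ring F\<^esub> (r, s) = (p + r, q + s)"
  "\<one>\<^bsub>coord_ring F\<^esub> = (1, 0)" "\<zero>\<^bsub>coord_ring F\<^esub> = (0, 0)"
  by (simp_all add: coord_ring_def)

lemma cring_coord_ring: "cring (coord_ring F)"
proof -
  have "\<exists>y. y \<oplus>\<^bsub>coord_ring F\<^esub> x = (0, 0)" for x
    by (rule exI[of _ "(- fst x, - snd x)"]) (cases x; simp)
  then show ?thesis
    by (intro cringI abelian_groupI comm_monoidI) (auto simp: algebra_simps)
qed

lemma ideal_coord_ringI:
  assumes "(0, 0) \<in> I" "\<And>g h. g \<in> I \<Longrightarrow> h \<in> I \<Longrightarrow> g \<oplus>\<^bsub>coord_ring F\<^esub> h \<in> I"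
    "\<And>g h. g \<in> I \<Longrightarrow> h \<otimes>\<^bsub>coord_ring F\<^esub> g \<in> I"
  shows "ideal I (coord_ring F)"
proof -
  interpret cring "coord_ring F"
    by (rule cring_coord_ring)
  have "inv\<^bsub>add_monoid (coord_ring F)\<^esub> g \<in> I" if "g \<in> I" for g
  proof -
    have "\<ominus>\<^bsub>coord_ring F\<^esub> g = (\<ominus>\<^bsub>coord_ring F\<^esub> \<one>\<^bsub>coord_ring F\<^esub>) \<otimes>\<^bsub>coord_ring F\<^esub> g"
      by (simp add: l_minus del: coord_ring_simps(2-))
    then show ?thesis
      using assms(3)[OF that] by (simp add: a_inv_def)
  qed
  then have "subgroup I (add_monoid (coord_ring F))"
    using assms(1,2) by (intro subgroup.intro) auto
  then show ?thesis
    using assms(3) m_comm[of _ _] by (intro idealI ring_axioms) (auto simp: m_comm)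
qed

lemma ideal_coord_ringD:
  assumes "ideal I (coord_ring F)"
  shows "(0, 0) \<in> I" "g \<in> I \<Longrightarrow> h \<in> I \<Longrightarrow> g \<oplus>\<^bsub>coord_ring F\<^esub> h \<in> I"
    "g \<in> I \<Longrightarrow> h \<otimes>\<^bsub>coord_ring F\<^esub> g \<in> I"
  using ideal.I_l_closed[OF assms, of g h]
    additive_subgroup.zero_closed[OF ideal.axioms(1)[OF assms]]
    additive_subgroup.a_closed[OF ideal.axioms(1)[OF assms], of g h]
  by auto

text \<open>\<open>p^2 - F q^2\<close> is the norm of \<open>p + q y\<close>, its product with the
  conjugate \<open>p - q y\<close>; hence it is multiplicative.\<close>

lemma coord_ring_norm:
  assumes "g \<otimes>\<^bsub>coord_ring F\<^esub> h = k"
  shows "(fst g ^ 2 - F * snd g ^ 2) * (fst h ^ 2 - F * snd h ^ 2) = fst k ^ 2 - F * snd k ^ 2"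
  unfolding assms[symmetric]
  by (cases g; cases h) (simp add: algebra_simps power2_eq_square)

text \<open>\<open>p^2\<close> has even and \<open>F q^2\<close> odd degree, so leading terms cannot
  cancel.\<close>

lemma degree_norm:
  fixes F :: "'k::field poly"
  assumes "odd (degree F)" and "q \<noteq> 0"
  shows "degree (p ^ 2 - F * q ^ 2) \<ge> degree F" "p ^ 2 - F * q ^ 2 \<noteq> 0"
proof -
  have F: "F \<noteq> 0"
    using assms by auto
  have deg: "degree (F * q ^ 2) = degree F + 2 * degree q"
    using F assms by (simp add: degree_mult_eq degree_power_eq)
  have "degree (p ^ 2) = 2 * degree p"
    by (cases "p = 0") (auto simp: degree_power_eq)
  then have "degree (p ^ 2) \<noteq> degree (F * q ^ 2)"
    unfolding deg using assms(1) by presburger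
  then have "degree (p ^ 2 - F * q ^ 2) \<ge> degree (F * q ^ 2)"
    using degree_add_eq_left[of "- (F * q ^ 2)" "p ^ 2"] degree_add_eq_right[of "p ^ 2" "- (F * q ^ 2)"]
    by (cases "degree (p ^ 2) < degree (F * q ^ 2)") auto
  then show "degree (p ^ 2 - F * q ^ 2) \<ge> degree F"
    using deg by simp
  then show "p ^ 2 - F * q ^ 2 \<noteq> 0"
    using assms(1) by (auto simp: odd_pos)
qed

lemma coord_ring_norm_eq_0_iff:
  fixes F :: "'k::field poly"
  assumes "odd (degree F)"
  shows "fst g ^ 2 - F * snd g ^ 2 = 0 \<longleftrightarrow> g = (0, 0)"
  using degree_norm(2)[OF assms, of "snd g" "fst g"] by (cases "snd g = 0"; cases g) auto

lemma domain_coord_ring: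
  fixes F :: "'k::field poly"
  assumes "odd (degree F)"
  shows "domain (coord_ring F)"
proof (intro domain.intro domain_axioms.intro cring_coord_ring)
  fix g h assume "g \<otimes>\<^bsub>coord_ring F\<^esub> h = \<zero>\<^bsub>coord_ring F\<^esub>"
  from coord_ring_norm[OF this] show "g = \<zero>\<^bsub>coord_ring F\<^esub> \<or> h = \<zero>\<^bsub>coord_ring F\<^esub>"
    by (simp add: coord_ring_norm_eq_0_iff[OF assms] del: mult_eq_0_iff)
       (metis assms coord_ring_norm_eq_0_iff mult_eq_0_iff)
qed simp

text \<open>The maximal ideal of an affine point of the curve. The point at infinity is not on the
  affine curve; with the unit ideal it represents the trivial class, as befits the neutral
  element.\<close>

definition point_ideal :: "'k::field point \<Rightarrow> ('k poly \<times> 'k poly) set" where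
  "point_ideal P = (case P of Infinity \<Rightarrow> UNIV
     | Affine x y \<Rightarrow> {h. poly (fst h) x + poly (snd h) x * y = 0})"

lemma point_ideal_Infinity [simp]: "point_ideal Infinity = UNIV"
  by (simp add: point_ideal_def)

lemma in_point_ideal_Affine [simp]:
  "h \<in> point_ideal (Affine x y) \<longleftrightarrow> poly (fst h) x + poly (snd h) x * y = 0"
  by (simp add: point_ideal_def)

fun on_graph :: "'k::field poly \<Rightarrow> 'k point \<Rightarrow> bool" where
  "on_graph F Infinity \<longleftrightarrow> True"
| "on_graph F (Affine x y) \<longleftrightarrow> poly F x = y ^ 2"

lemma ideal_point_ideal:
  assumes "on_graph F P"
  shows "ideal (point_ideal P) (coord_ring F)"
proof (cases P)
  case (Affine x y)
  \<comment> \<open>Evaluation at \<open>(x, y)\<close> respects products because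
    \<open>y^2 = F(x)\<close>.\<close>
  have *: "poly (fst h) x * poly (fst g) x + poly F x * poly (snd h) x * poly (snd g) x +
      (poly (fst h) x * poly (snd g) x + poly (snd h) x * poly (fst g) x) * y =
      (poly (fst h) x + poly (snd h) x * y) * (poly (fst g) x + poly (snd g) x * y)" for g h
    using assms Affine by (simp add: algebra_simps power2_eq_square)
  have "poly (fst (g \<oplus>\<^bsub>coord_ring F\<^esub> h)) x + poly (snd (g \<oplus>\<^bsub>coord_ring F\<^esub> h)) x * y =
    (poly (fst g) x + poly (snd g) x * y) + (poly (fst h) x + poly (snd h) x * y)" for g h
    by (cases g; cases h) (simp add: algebra_simps)
  moreover have "poly (fst (h \<otimes>\<^bsub>coord_ring F\<^esub> g)) x + poly (snd (h \<otimes>\<^bsub>coord_ring F\<^esub> g)) x * y =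
    (poly (fst h) x + poly (snd h) x * y) * (poly (fst g) x + poly (snd g) x * y)" for g h
    using *[of h g] by (cases g; cases h) simp
  ultimately show ?thesis
    unfolding Affine by (intro ideal_coord_ringI) auto
next
  case Infinity
  then show ?thesis
    by (auto intro: ideal_coord_ringI)
qed

lemma coord_ring_ideal_prod_minimal:
  assumes "ideal K (coord_ring F)"
    and "\<And>g h. g \<in> I \<Longrightarrow> h \<in> J \<Longrightarrow> g \<otimes>\<^bsub>coord_ring F\<^esub> h \<in> K"
  shows "I \<cdot>\<^bsub>coord_ring F\<^esub> J \<subseteq> K"
proof
  fix g assume "g \<in> I \<cdot>\<^bsub>coord_ring F\<^esub> J"
  then show "g \<in> K"
    by induction (auto intro: assms(2) ideal_coord_ringD(2)[OF assms(1)])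
qed

section \<open>Ideals of vertical lines, chords and tangents\<close>

locale twisted_curve =
  fixes a :: "'k::field"
  assumes two: "(2::'k) \<noteq> 0" and a_nz: "a \<noteq> 0"
begin

definition F :: "'k poly" where "F = smult (inverse a) [:0, -1, 0, 1:]"

abbreviation R where "R \<equiv> coord_ring F"
abbreviation pidl where "pidl g \<equiv> PIdl\<^bsub>R\<^esub> g"
abbreviation iprod (infixl "\<star>" 80) where "I \<star> J \<equiv> I \<cdot>\<^bsub>R\<^esub> J"

lemma degree_F: "degree F = 3"
  using a_nz by (simp add: F_def)

sublocale R: domain R
  by (rule domain_coord_ring) (simp add: degree_F)

text \<open>The roots of \<open>x^3 - x\<close> are simple: either \<open>e = 0\<close> or
  \<open>e^2 = 1\<close>, and the derivative is \<open>-1\<close> or \<open>2\<close>.\<close>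

lemma two_torsion_deriv_nz:
  assumes "e ^ 3 = e"
  shows "3 * e ^ 2 - 1 \<noteq> (0 :: 'k)"
proof -
  have "e * (e ^ 2 - 1) = 0"
    using assms by (simp add: algebra_simps power2_eq_square power3_eq_cube)
  then have "3 * e ^ 2 - 1 = - 1 \<or> 3 * e ^ 2 - 1 = 2"
    by auto
  then show ?thesis
    using two by (metis neg_equal_0_iff_equal one_neq_zero)
qed

lemma on_graph_F_iff: "on_graph F P \<longleftrightarrow> P \<in> curve_points a"
proof (cases P)
  case (Affine x y)
  have "smult a F = [:0, -1, 0, 1:]"
    using a_nz by (simp add: F_def)
  then have "poly (smult a F) x = x ^ 3 - x"
    by (simp add: algebra_simps power3_eq_cube)
  then have "a * poly F x = x ^ 3 - x"
    by simp
  then have "Affine x y \<in> curve_points a \<longleftrightarrow> a * y ^ 2 = a * poly F x"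
    by simp
  then show ?thesis
    using Affine a_nz by auto
qed simp

lemma ideal_point [simp, intro]: "P \<in> curve_points a \<Longrightarrow> ideal (point_ideal P) R"
  by (simp add: ideal_point_ideal on_graph_F_iff)

lemma in_PIdl: "h \<in> pidl g \<longleftrightarrow> (\<exists>k. h = k \<otimes>\<^bsub>R\<^esub> g)"
  by (auto simp: cgenideal_def)

lemma ideal_PIdl [simp, intro]: "ideal (pidl g) R"
  by (rule R.cgenideal_ideal) simp

lemma in_PIdl_poly: "h \<in> pidl (p, 0) \<longleftrightarrow> p dvd fst h \<and> p dvd snd h"
  by (cases h) (auto simp: in_PIdl dvd_def mult.commute)

text \<open>A vertical line meets the affine curve in a point and its negative. With
  \<open>v = X - x\<close>, the product of the ideals contains \<open>2 y v\<close>,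
  \<open>v^2\<close> and \<open>G v\<close>. If \<open>y = 0\<close>, then \<open>G\<close> does not
  vanish at \<open>x\<close>, as the root is simple. In both cases \<open>v\<close> itself is in the
  product.\<close>

lemma vertical_ideal_prod:
  assumes "a * y ^ 2 = x ^ 3 - x"
  shows "point_ideal (Affine x y) \<star> point_ideal (Affine x (- y)) = pidl ([:- x, 1:], 0)"
proof
  let ?v = "[:- x, 1:]"
  let ?I = "point_ideal (Affine x y)" and ?J = "point_ideal (Affine x (- y))"
  \<comment> \<open>The quotient of \<open>F - y^2\<close> by \<open>X - x\<close>.\<close>
  define G where "G = smult (inverse a) [:x ^ 2 - 1, x, 1:]"
  have "y ^ 2 = inverse a * (x ^ 3 - x)"
    using assms a_nz by (simp add: field_simps)
  then have F: "F = [:y ^ 2:] + ?v * G"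
    by (simp add: F_def G_def power2_eq_square power3_eq_cube algebra_simps)
  show "?I \<star> ?J \<subseteq> pidl (?v, 0)"
  proof (rule coord_ring_ideal_prod_minimal)
    fix g h assume g: "g \<in> ?I" and h: "h \<in> ?J"
    obtain p q r s where gh: "g = (p, q)" "h = (r, s)"
      by (cases g; cases h)
    have "?v dvd p + smult y q"
      using g by (simp add: gh poly_eq_0_iff_dvd[symmetric] mult.commute)
    then obtain b where "p + smult y q = ?v * b"
      by blast
    then have p: "p = ?v * b - smult y q"
      by (simp add: algebra_simps)
    have "?v dvd r - smult y s"
      using h by (simp add: gh poly_eq_0_iff_dvd[symmetric] mult.commute)
    then obtain c where "r - smult y s = ?v * c"
      by blast
    then have r: "r = ?v * c + smult y s"
      by (simp add: algebra_simps)
    have "p * r + F * q * s = ?v * (b * r - smult y q * c + G * q * s)"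
      unfolding F p r by (simp add: algebra_simps power2_eq_square)
    moreover have "p * s + q * r = ?v * (b * s + q * c)"
      unfolding p r by (simp add: algebra_simps)
    ultimately show "g \<otimes>\<^bsub>R\<^esub> h \<in> pidl (?v, 0)"
      unfolding gh coord_ring_simps in_PIdl_poly fst_conv snd_conv by (metis dvd_triv_left)
  qed simp
  have "a * (- y) ^ 2 = x ^ 3 - x"
    using assms by simp
  then have K: "ideal (?I \<star> ?J) R"
    using assms by (intro R.ideal_prod_is_ideal ideal_point) simp_all
  have prod: "g \<in> ?I \<Longrightarrow> h \<in> ?J \<Longrightarrow> g \<otimes>\<^bsub>R\<^esub> h \<in> ?I \<star> ?J" for g h
    by (rule ideal_prod.prod)
  have "(?v, 0) \<otimes>\<^bsub>R\<^esub> ([:y:], 1) \<in> ?I \<star> ?J" "([:- y:], 1) \<otimes>\<^bsub>R\<^esub> (?v, 0) \<in> ?I \<star> ?J"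
    by (intro prod; simp)+
  from ideal_coord_ringD(2)[OF K this(1) ideal_coord_ringD(3)[OF K this(2), of "(- 1, 0)"]]
  have y: "([:2 * y:] * ?v, 0) \<in> ?I \<star> ?J"
    by (simp add: algebra_simps)
  have "([:- y:], 1) \<otimes>\<^bsub>R\<^esub> ([:y:], 1) \<in> ?I \<star> ?J"
    by (intro prod) simp_all
  then have G: "(G * ?v, 0) \<in> ?I \<star> ?J"
    unfolding F by (simp add: power2_eq_square algebra_simps)
  have v: "(?v, 0) \<otimes>\<^bsub>R\<^esub> (?v, 0) \<in> ?I \<star> ?J"
    by (intro prod) simp_all
  have "(?v, 0) \<in> ?I \<star> ?J"
  proof (cases "y = 0")
    case False
    then show ?thesis
      using ideal_coord_ringD(3)[OF K y, of "([:inverse (2 * y):], 0)"] two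
      by (simp add: field_simps)
  next
    case True
    define d where "d = 3 * x ^ 2 - 1"
    have c: "d \<noteq> 0"
      using two_torsion_deriv_nz[of x] assms True by (simp add: d_def)
    have "smult a G = ?v * [:2 * x, 1:] + [:d:]"
      using a_nz by (simp add: G_def d_def power2_eq_square algebra_simps)
    then have c_eq: "[:d:] = smult a G + - ([:2 * x, 1:] * ?v)"
      by (simp add: algebra_simps)
    have "([:d:] * ?v, 0) \<in> ?I \<star> ?J"
      using ideal_coord_ringD(2)[OF K ideal_coord_ringD(3)[OF K G, of "([:a:], 0)"]
          ideal_coord_ringD(3)[OF K v, of "(- [:2 * x, 1:], 0)"]]
      unfolding c_eq by (simp add: algebra_simps)
    from ideal_coord_ringD(3)[OF K this, of "([:inverse (d):], 0)"] show ?thesis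
      using c by (simp add: field_simps)
  qed
  then show "pidl (?v, 0) \<subseteq> ?I \<star> ?J"
    by (intro R.cgenideal_minimal K)
qed

text \<open>Setting \<open>y = m\<close> sends \<open>p + q y\<close> to \<open>p + m q\<close>.
  This is multiplicative up to multiples of \<open>F - m^2\<close>, which \<open>A * B\<close>
  divides.\<close>

lemma line_dvd_ideal_prod:
  assumes "\<And>h. h \<in> I \<Longrightarrow> A dvd fst h + m * snd h" "\<And>h. h \<in> J \<Longrightarrow> B dvd fst h + m * snd h"
    and "A * B dvd F - m ^ 2" and "h \<in> I \<star> J"
  shows "A * B dvd fst h + m * snd h"
  using assms(4)
proof induction
  case (prod g h)
  obtain p q r s where gh: "g = (p, q)" "h = (r, s)"
    by (cases g; cases h)
  have "A * B dvd (p + m * q) * (r + m * s) + (F - m ^ 2) * (q * s)"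
    using assms(1)[OF prod(1)] assms(2)[OF prod(2)] assms(3) gh
    by (intro dvd_add[OF mult_dvd_mono dvd_mult2]) auto
  also have "\<dots> = fst (g \<otimes>\<^bsub>R\<^esub> h) + m * snd (g \<otimes>\<^bsub>R\<^esub> h)"
    by (simp add: gh algebra_simps power2_eq_square)
  finally show ?case .
next
  case (sum g h)
  have "fst (g \<oplus>\<^bsub>R\<^esub> h) + m * snd (g \<oplus>\<^bsub>R\<^esub> h) = (fst g + m * snd g) + (fst h + m * snd h)"
    by (cases g; cases h) (simp add: algebra_simps)
  then show ?case
    using sum.IH by (metis dvd_add)
qed

text \<open>The three points are the zeros, with multiplicity, of the function
  \<open>y - (l x + \<nu>)\<close>, so it generates the product of their ideals.\<close>

lemma line_ideal_prod:
  assumes s1: "x1 + x2 + x3 = a * l ^ 2"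
    and s2: "x1 * x2 + x1 * x3 + x2 * x3 = - 1 - 2 * a * l * \<nu>"
    and s3: "x1 * x2 * x3 = a * \<nu> ^ 2"
    and on_curve: "Affine x1 (l * x1 + \<nu>) \<in> curve_points a" "Affine x2 (l * x2 + \<nu>) \<in> curve_points a"
      "Affine x3 (l * x3 + \<nu>) \<in> curve_points a"
  shows "point_ideal (Affine x1 (l * x1 + \<nu>)) \<star> point_ideal (Affine x2 (l * x2 + \<nu>)) \<star>
      point_ideal (Affine x3 (l * x3 + \<nu>)) = pidl (- [:\<nu>, l:], 1)"
    (is "?I1 \<star> ?I2 \<star> ?I3 = _")
proof
  let ?I = "?I1 \<star> ?I2 \<star> ?I3"
  define m where "m = [:\<nu>, l:]"
  define v where "v = (\<lambda>x::'k. [:- x, 1:])"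
  have vvv: "v x1 * v x2 * v x3 = smult a (F - m ^ 2)"
  proof -
    have "v x1 * v x2 * v x3 =
        [:- (x1 * x2 * x3), x1 * x2 + x1 * x3 + x2 * x3, - (x1 + x2 + x3), 1:]"
      by (simp add: v_def algebra_simps)
    also have "\<dots> = smult a (F - m ^ 2)"
      unfolding s1 s2 s3 using a_nz
      by (simp add: F_def m_def power2_eq_square smult_diff_right algebra_simps)
    finally show ?thesis .
  qed
  have vvv_dvd: "v x1 * v x2 * v x3 dvd F - m ^ 2"
    unfolding vvv using a_nz by (simp add: smult_dvd)
  have gen: "h \<in> point_ideal (Affine x (l * x + \<nu>)) \<longleftrightarrow> v x dvd fst h + m * snd h" for h x
    unfolding v_def poly_eq_0_iff_dvd[symmetric] m_def by (simp add: algebra_simps)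
  show "?I \<subseteq> pidl (- [:\<nu>, l:], 1)"
  proof
    fix h assume "h \<in> ?I"
    have "v x1 * v x2 * v x3 dvd fst h + m * snd h"
      by (rule line_dvd_ideal_prod[OF line_dvd_ideal_prod[of ?I1 "v x1" m ?I2 "v x2"] _ vvv_dvd \<open>h \<in> ?I\<close>])
         (use dvd_mult_left[OF vvv_dvd] gen in auto)
    then obtain c where "fst h + m * snd h = smult a (F - m ^ 2) * c"
      unfolding vvv by blast
    then have "fst h = - m * snd h + smult a (F - m ^ 2) * c"
      by (simp add: algebra_simps)
    \<comment> \<open>As \<open>F - m^2 = (y - m) (y + m)\<close> in the coordinate ring,
      \<open>y - m\<close> can be factored out of \<open>h\<close>.\<close>
    then have "h = (snd h + smult a (m * c), smult a c) \<otimes>\<^bsub>R\<^esub> (- m, 1)"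
      by (cases h) (simp add: algebra_simps power2_eq_square smult_diff_right)
    then show "h \<in> pidl (- [:\<nu>, l:], 1)"
      unfolding in_PIdl m_def[symmetric] by blast
  qed
  have I: "ideal ?I R"
    using on_curve by (intro R.ideal_prod_is_ideal ideal_point)
  \<comment> \<open>The quotient ideal \<open>J\<close> contains \<open>F\<close>, \<open>m\<^sup>2\<close> and \<open>f' - 2 a l m\<close>, where \<open>f = a F = x\<^sup>3 - x\<close>.  As \<open>f\<close> and
    \<open>f'\<close> are coprime, \<open>m\<close> is invertible and nilpotent modulo \<open>J\<close>, hence \<open>J\<close> is the unit ideal.\<close>
  define J where "J = {h. (- m, 1) \<otimes>\<^bsub>R\<^esub> h \<in> ?I}"
  have J: "ideal J R"
  proof (rule ideal_coord_ringI)
    show "(0, 0) \<in> J"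
      using ideal_coord_ringD(1)[OF I] by (simp add: J_def)
    show "g \<oplus>\<^bsub>R\<^esub> h \<in> J" if "g \<in> J" "h \<in> J" for g h
      using that ideal_coord_ringD(2)[OF I] by (simp add: J_def R.r_distr del: coord_ring_simps(2-))
    show "h \<otimes>\<^bsub>R\<^esub> g \<in> J" if "g \<in> J" for g h
      using that ideal_coord_ringD(3)[OF I] by (simp add: J_def R.m_lcomm del: coord_ring_simps(2-))
  qed
  have prod: "g \<otimes>\<^bsub>R\<^esub> h \<otimes>\<^bsub>R\<^esub> k \<in> ?I" if "g \<in> ?I1" "h \<in> ?I2" "k \<in> ?I3" for g h k
    using that by (intro ideal_prod.prod)
  have v_in: "(v x, 0) \<in> point_ideal (Affine x (l * x + \<nu>))"
    and m_in: "(- m, 1) \<in> point_ideal (Affine x (l * x + \<nu>))" for x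
    by (simp_all add: v_def m_def)
  have add: "(p + r, q + s) \<in> J" if "(p, q) \<in> J" "(r, s) \<in> J" for p q r s
    using ideal_coord_ringD(2)[OF J that] by simp
  have mult: "(c * p, c * q) \<in> J" if "(p, q) \<in> J" for c p q
    using ideal_coord_ringD(3)[OF J that, of "(c, 0)"] by simp
  have conj: "(m, 1) \<in> J"
  proof -
    have "(v x1 * v x2 * v x3, 0) \<in> ?I"
      using prod[OF v_in v_in v_in] by simp
    from ideal_coord_ringD(3)[OF I this, of "([:inverse a:], 0)"] show ?thesis
      unfolding vvv using a_nz by (simp add: J_def power2_eq_square)
  qed
  have "(- m, 1) \<otimes>\<^bsub>R\<^esub> (- m, 1) \<in> J"
    using prod[OF m_in m_in m_in] by (simp add: J_def algebra_simps)
  then have sq: "(m ^ 2 + F, - 2 * m) \<in> J"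
    by (simp add: power2_eq_square)
  have "(- m, 1) \<otimes>\<^bsub>R\<^esub> (m, 1) \<in> J"
    by (rule ideal_coord_ringD(3)[OF J conj])
  then have norm: "(F - m ^ 2, 0) \<in> J"
    by (simp add: power2_eq_square)
  \<comment> \<open>\<open>(y - m)^2 + 2 m (y + m) - (F - m^2) = 4 m^2\<close>, since
    \<open>y^2 = F\<close>.\<close>
  have "(4 * m ^ 2, 0) \<in> J"
    using add[OF add[OF sq mult[OF conj, of "2 * m"]] mult[OF norm, of "- 1"]]
    by (simp add: algebra_simps power2_eq_square)
  have four: "(4 :: 'k) \<noteq> 0"
    using two by (metis mult_2 mult_eq_0_iff numeral_Bit0)
  from mult[OF \<open>(4 * m ^ 2, 0) \<in> J\<close>, of "[:inverse 4:]"] have m2: "(m ^ 2, 0) \<in> J"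
    using four by (simp add: numeral_poly)
  have F_in: "(F, 0) \<in> J"
    using add[OF m2 norm] by simp
  have "(v x1 * v x2, 0) \<in> J" "(v x1 * v x3, 0) \<in> J" "(v x2 * v x3, 0) \<in> J"
    using prod[OF v_in v_in m_in] prod[OF v_in m_in v_in] prod[OF m_in v_in v_in]
    by (simp_all add: J_def algebra_simps)
  \<comment> \<open>The sum is the derivative of the product of the three linear factors, that is,
    of \<open>x^3 - x - a m^2\<close>.\<close>
  from add[OF add[OF this(1,2)] this(3)]
  have deriv: "(v x1 * v x2 + v x1 * v x3 + v x2 * v x3, 0) \<in> J"
    by simp
  \<comment> \<open>From the Bezout identity
    \<open>(2 - 3 x^2) (3 x^2 - 1) + 9 x (x^3 - x) = -2\<close>.\<close>
  define w :: "'k poly" where "w = [:2, 0, -3:]"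
  have deriv_eq: "v x1 * v x2 + v x1 * v x3 + v x2 * v x3 = [:-1, 0, 3:] - smult (2 * a * l) m"
  proof -
    have "v x1 * v x2 + v x1 * v x3 + v x2 * v x3 =
        [:x1 * x2 + x1 * x3 + x2 * x3, - 2 * (x1 + x2 + x3), 3:]"
      by (simp add: v_def algebra_simps)
    also have "\<dots> = [:-1, 0, 3:] - smult (2 * a * l) m"
      unfolding s1 s2 by (simp add: m_def power2_eq_square algebra_simps)
    finally show ?thesis .
  qed
  have "w * [:-1, 0, 3:] + [:0, 9 * a:] * F = - 2"
    using a_nz by (simp add: w_def F_def algebra_simps numeral_poly)
  then have "w * ([:-1, 0, 3:] - smult (2 * a * l) m) + [:0, 9 * a:] * F = - 2 - smult (2 * a * l) (w * m)"
    by (simp add: algebra_simps)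
  with add[OF mult[OF deriv, of w] mult[OF F_in, of "[:0, 9 * a:]"]]
  have "(- 2 - smult (2 * a * l) (w * m), 0) \<in> J"
    unfolding deriv_eq by simp
  \<comment> \<open>\<open>(-2 - u m) (-2 + u m) + u^2 m^2 = 4\<close> with
    \<open>u = 2 a l w\<close>.\<close>
  from add[OF mult[OF this, of "- 2 + smult (2 * a * l) (w * m)"]
      mult[OF m2, of "(smult (2 * a * l) w) ^ 2"]]
  have "(4, 0) \<in> J"
    by (simp add: algebra_simps power2_eq_square)
  from mult[OF this, of "[:inverse 4:]"] have "(1, 0) \<in> J"
    using four by (simp add: numeral_poly one_pCons)
  then have "(- m, 1) \<in> ?I"
    by (simp add: J_def)
  then show "pidl (- [:\<nu>, l:], 1) \<subseteq> ?I"
    unfolding m_def[symmetric] by (intro R.cgenideal_minimal I)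
qed

section \<open>Principal ideals and ideal classes\<close>

lemma PIdl_prod:
  assumes "ideal K R"
  shows "pidl g \<star> K = {g \<otimes>\<^bsub>R\<^esub> k | k. k \<in> K}"
proof
  have K: "ideal {g \<otimes>\<^bsub>R\<^esub> k | k. k \<in> K} R"
  proof (rule ideal_coord_ringI)
    show "(0, 0) \<in> {g \<otimes>\<^bsub>R\<^esub> k | k. k \<in> K}"
    proof -
      have "(0, 0) = g \<otimes>\<^bsub>R\<^esub> (0, 0)"
        by (cases g) simp
      then show ?thesis
        using ideal_coord_ringD(1)[OF assms] by blast
    qed
    show "u \<oplus>\<^bsub>R\<^esub> v \<in> {g \<otimes>\<^bsub>R\<^esub> k | k. k \<in> K}"
      if "u \<in> {g \<otimes>\<^bsub>R\<^esub> k | k. k \<in> K}" "v \<in> {g \<otimes>\<^bsub>R\<^esub> k | k. k \<in> K}" for u v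
    proof -
      from that obtain k k' where "u = g \<otimes>\<^bsub>R\<^esub> k" "v = g \<otimes>\<^bsub>R\<^esub> k'" and k: "k \<in> K" "k' \<in> K"
        by blast
      then have "u \<oplus>\<^bsub>R\<^esub> v = g \<otimes>\<^bsub>R\<^esub> (k \<oplus>\<^bsub>R\<^esub> k')"
        by (simp add: R.r_distr del: coord_ring_simps(2-))
      then show ?thesis
        using ideal_coord_ringD(2)[OF assms k] by blast
    qed
    show "v \<otimes>\<^bsub>R\<^esub> u \<in> {g \<otimes>\<^bsub>R\<^esub> k | k. k \<in> K}" if "u \<in> {g \<otimes>\<^bsub>R\<^esub> k | k. k \<in> K}" for u v
    proof -
      from that obtain k where "u = g \<otimes>\<^bsub>R\<^esub> k" and k: "k \<in> K"
        by blast
      then have "v \<otimes>\<^bsub>R\<^esub> u = g \<otimes>\<^bsub>R\<^esub> (v \<otimes>\<^bsub>R\<^esub> k)"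
        by (simp add: R.m_lcomm del: coord_ring_simps(2-))
      then show ?thesis
        using ideal_coord_ringD(3)[OF assms k] by blast
    qed
  qed
  show "pidl g \<star> K \<subseteq> {g \<otimes>\<^bsub>R\<^esub> k | k. k \<in> K}"
  proof (rule coord_ring_ideal_prod_minimal[OF K])
    fix u v assume "u \<in> pidl g" "v \<in> K"
    then obtain k where "u = k \<otimes>\<^bsub>R\<^esub> g"
      by (auto simp: in_PIdl)
    then have "u \<otimes>\<^bsub>R\<^esub> v = g \<otimes>\<^bsub>R\<^esub> (k \<otimes>\<^bsub>R\<^esub> v)"
      by (simp add: R.m_ac del: coord_ring_simps(2-))
    then show "u \<otimes>\<^bsub>R\<^esub> v \<in> {g \<otimes>\<^bsub>R\<^esub> k | k. k \<in> K}"
      using ideal_coord_ringD(3)[OF assms \<open>v \<in> K\<close>] by blast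
  qed
  show "{g \<otimes>\<^bsub>R\<^esub> k | k. k \<in> K} \<subseteq> pidl g \<star> K"
    using R.cgenideal_self[of g] by (auto intro: ideal_prod.prod)
qed

lemma PIdl_prod_PIdl: "pidl g \<star> pidl h = pidl (g \<otimes>\<^bsub>R\<^esub> h)"
proof -
  have "k \<otimes>\<^bsub>R\<^esub> (g \<otimes>\<^bsub>R\<^esub> h) = g \<otimes>\<^bsub>R\<^esub> (k \<otimes>\<^bsub>R\<^esub> h)" for k
    by (rule R.m_lcomm) simp_all
  then show ?thesis
    unfolding PIdl_prod[OF ideal_PIdl] set_eq_iff mem_Collect_eq in_PIdl by metis
qed

lemma ideal_prod_swap:
  assumes [simp]: "ideal I R" "ideal J R" "ideal K R" "ideal L R"
  shows "(I \<star> J) \<star> (K \<star> L) = (I \<star> K) \<star> (J \<star> L)"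
proof -
  have "J \<star> (K \<star> L) = K \<star> (J \<star> L)"
    using R.ideal_prod_assoc[of J K L] R.ideal_prod_assoc[of K J L] R.ideal_prod_commute[of J K] by simp
  then show ?thesis
    by (simp add: R.ideal_prod_assoc R.ideal_prod_is_ideal)
qed

lemma PIdl_prod_cancel:
  assumes "ideal K R" "ideal K' R" "g \<noteq> (0, 0)" "pidl g \<star> K = pidl g \<star> K'"
  shows "K = K'"
proof -
  have "k \<in> L'" if "ideal L R" "ideal L' R" "pidl g \<star> L = pidl g \<star> L'" "k \<in> L" for k L L'
  proof -
    have "g \<otimes>\<^bsub>R\<^esub> k \<in> {g \<otimes>\<^bsub>R\<^esub> k | k. k \<in> L'}"
      using that unfolding PIdl_prod[OF that(1)] PIdl_prod[OF that(2)] by blast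
    then obtain k' where "g \<otimes>\<^bsub>R\<^esub> k = g \<otimes>\<^bsub>R\<^esub> k'" "k' \<in> L'"
      by blast
    then show ?thesis
      using R.m_lcancel[of g k k'] assms(3) by (simp del: coord_ring_simps(2,3))
  qed
  then show ?thesis
    using assms by blast
qed

text \<open>Equality in the ideal class group of the coordinate ring.\<close>

definition ideal_equiv :: "('k poly \<times> 'k poly) set \<Rightarrow> ('k poly \<times> 'k poly) set \<Rightarrow> bool" where
  "ideal_equiv I J \<longleftrightarrow>
     (\<exists>f g. f \<noteq> (0, 0) \<and> g \<noteq> (0, 0) \<and> pidl f \<star> I = pidl g \<star> J)"

lemma ideal_equivI:
  "f \<noteq> (0, 0) \<Longrightarrow> g \<noteq> (0, 0) \<Longrightarrow> pidl f \<star> I = pidl g \<star> J \<Longrightarrow> ideal_equiv I J"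
  unfolding ideal_equiv_def by blast

lemma ideal_equiv_refl: "ideal_equiv I I"
  by (rule ideal_equivI[of "(1, 0)" "(1, 0)"]) simp_all

lemma ideal_equiv_sym: "ideal_equiv I J \<Longrightarrow> ideal_equiv J I"
  unfolding ideal_equiv_def by metis

lemma coord_ring_mult_nz: "f \<noteq> (0, 0) \<Longrightarrow> g \<noteq> (0, 0) \<Longrightarrow> f \<otimes>\<^bsub>R\<^esub> g \<noteq> (0, 0)"
  using R.integral[of f g] by (auto simp del: coord_ring_simps(2,3))

lemma ideal_equiv_trans:
  assumes "ideal_equiv I J" "ideal_equiv J K" and [simp]: "ideal I R" "ideal J R" "ideal K R"
  shows "ideal_equiv I K"
proof -
  obtain f g where fg: "f \<noteq> (0, 0)" "g \<noteq> (0, 0)" "pidl f \<star> I = pidl g \<star> J"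
    using assms(1) by (auto simp: ideal_equiv_def)
  obtain f' g' where fg': "f' \<noteq> (0, 0)" "g' \<noteq> (0, 0)" "pidl f' \<star> J = pidl g' \<star> K"
    using assms(2) by (auto simp: ideal_equiv_def)
  have "pidl (f' \<otimes>\<^bsub>R\<^esub> f) \<star> I = pidl f' \<star> (pidl g \<star> J)"
    by (simp add: PIdl_prod_PIdl[symmetric] R.ideal_prod_assoc fg del: coord_ring_simps(2-))
  also have "\<dots> = pidl g \<star> (pidl f' \<star> J)"
    by (metis R.ideal_prod_assoc R.ideal_prod_commute assms(4) ideal_PIdl)
  also have "\<dots> = pidl (g \<otimes>\<^bsub>R\<^esub> g') \<star> K"
    by (simp add: PIdl_prod_PIdl[symmetric] R.ideal_prod_assoc fg' del: coord_ring_simps(2-))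
  finally show ?thesis
    using fg fg' coord_ring_mult_nz by (intro ideal_equivI)
qed

lemma ideal_equiv_prod_right:
  assumes "ideal_equiv I J" and [simp]: "ideal I R" "ideal J R" "ideal K R"
  shows "ideal_equiv (I \<star> K) (J \<star> K)"
  using assms(1) unfolding ideal_equiv_def by (metis R.ideal_prod_assoc assms(2-4) ideal_PIdl)

lemma ideal_equiv_prod_left:
  assumes "ideal_equiv I J" and "ideal I R" "ideal J R" "ideal K R"
  shows "ideal_equiv (K \<star> I) (K \<star> J)"
  using ideal_equiv_prod_right[OF assms] assms R.ideal_prod_commute by metis

text \<open>The value at \<open>Infinity\<close> makes \<open>point_ideal_prod_neg\<close> hold
  there as well.\<close>

definition vertical :: "'k point \<Rightarrow> 'k poly" where
  "vertical P = (case P of Infinity \<Rightarrow> 1 | Affine x y \<Rightarrow> [:- x, 1:])"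

lemma vertical_nz: "vertical P \<noteq> 0" and degree_vertical_le: "degree (vertical P) \<le> 1"
  by (auto simp: vertical_def split: point.splits)

lemma PIdl_one: "pidl (1, 0) = UNIV"
  by (auto simp: in_PIdl_poly)

lemma point_ideal_prod_neg:
  assumes "P \<in> curve_points a"
  shows "point_ideal P \<star> point_ideal (point_neg P) = pidl (vertical P, 0)"
proof (cases P)
  case Infinity
  have "UNIV \<star> UNIV = (UNIV :: ('k poly \<times> 'k poly) set)"
    using R.ideal_prod_one[OF R.oneideal] by simp
  then show ?thesis
    by (simp add: Infinity vertical_def PIdl_one)
next
  case (Affine x y)
  then show ?thesis
    using vertical_ideal_prod assms by (simp add: vertical_def)
qed

text \<open>The points \<open>P\<close>, \<open>Q\<close> and \<open>-(P + Q)\<close> lie on a line,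
  so the product of their ideals is principal. So is the product for \<open>P + Q\<close> and
  \<open>-(P + Q)\<close>, and comparing the two gives the equivalence.\<close>

lemma point_ideal_prod_equiv:
  assumes P: "P \<in> curve_points a" and Q: "Q \<in> curve_points a"
  shows "ideal_equiv (point_ideal P \<star> point_ideal Q) (point_ideal (point_add a P Q))"
proof (cases "P = Infinity \<or> Q = Infinity")
  case True
  have "point_ideal S \<star> UNIV = point_ideal S" "UNIV \<star> point_ideal S = point_ideal S"
    if "S \<in> curve_points a" for S
    using R.ideal_prod_one[OF ideal_point[OF that]] R.ideal_prod_commute[OF ideal_point[OF that] R.oneideal]
    by simp_all
  then show ?thesis
    using True P Q by (auto simp: ideal_equiv_refl)
next
  case False
  then obtain x1 y1 x2 y2 where PQ: "P = Affine x1 y1" "Q = Affine x2 y2"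
    by (metis point.exhaust)
  show ?thesis
  proof (cases "x1 = x2 \<and> y1 = - y2")
    case True
    then have Q_eq: "Q = point_neg P" and add: "point_add a P Q = Infinity"
      by (simp_all add: PQ)
    have "pidl (1, 0) \<star> (point_ideal P \<star> point_ideal Q) =
        pidl (vertical P, 0) \<star> pidl (1, 0)"
      unfolding Q_eq point_ideal_prod_neg[OF P] PIdl_prod_PIdl by simp
    then show ?thesis
      unfolding add point_ideal_Infinity PIdl_one[symmetric]
      by (rule ideal_equivI[rotated 2]) (simp_all add: vertical_nz)
  next
    case False
    from P Q have "a * y1 ^ 2 = x1 ^ 3 - x1" "a * y2 ^ 2 = x2 ^ 3 - x2"
      by (simp_all add: PQ)
    from point_add_line[OF two a_nz this False] show ?thesis
    proof cases
      case (1 l \<nu> x3)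
      let ?S = "point_add a P Q"
      have S: "?S = Affine x3 (- (l * x3 + \<nu>))"
        using 1(1) by (simp only: PQ)
      have S_in: "?S \<in> curve_points a"
        using point_add_closed[OF two a_nz P Q] .
      have neg_S: "point_neg ?S = Affine x3 (l * x3 + \<nu>)"
        by (simp add: S)
      have ideals [simp]: "ideal (point_ideal P) R" "ideal (point_ideal Q) R" "ideal (point_ideal ?S) R"
        "ideal (point_ideal (point_neg ?S)) R"
        using P Q S_in by (auto simp del: point_add.simps)
      have line: "point_ideal P \<star> point_ideal Q \<star> point_ideal (point_neg ?S) =
          pidl (- [:\<nu>, l:], 1)"
      proof -
        have "Affine x3 (l * x3 + \<nu>) \<in> curve_points a"
          using S_in by (simp only: neg_S[symmetric] point_neg_in_curve_points)
        then have "point_ideal (Affine x1 (l * x1 + \<nu>)) \<star> point_ideal (Affine x2 (l * x2 + \<nu>)) \<star>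
            point_ideal (Affine x3 (l * x3 + \<nu>)) = pidl (- [:\<nu>, l:], 1)"
          using P Q unfolding PQ 1(2,3) by (intro line_ideal_prod[OF 1(4-6)])
        then show ?thesis
          unfolding neg_S unfolding PQ 1(2,3)[symmetric] .
      qed
      have "pidl (vertical ?S, 0) \<star> (point_ideal P \<star> point_ideal Q) =
          (point_ideal P \<star> point_ideal Q) \<star> (point_ideal (point_neg ?S) \<star> point_ideal ?S)"
        unfolding point_ideal_prod_neg[OF S_in, symmetric]
        by (metis R.ideal_prod_commute R.ideal_prod_is_ideal ideals)
      also have "\<dots> = pidl (- [:\<nu>, l:], 1) \<star> point_ideal ?S"
        unfolding line[symmetric] by (simp add: R.ideal_prod_assoc R.ideal_prod_is_ideal del: point_add.simps)
      finally show ?thesis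
        by (intro ideal_equivI) (simp_all add: vertical_nz del: point_add.simps)
    qed
  qed
qed

section \<open>Conjugation, norms and injectivity on ideal classes\<close>

lemma conj_in_ideal_prod:
  assumes "P \<in> curve_points a" "Q \<in> curve_points a" "h \<in> point_ideal P \<star> point_ideal Q"
  shows "(fst h, - snd h) \<in> point_ideal (point_neg P) \<star> point_ideal (point_neg Q)"
  using assms(3)
proof induction
  case (prod g h)
  have "(fst u, - snd u) \<in> point_ideal (point_neg S)" if "u \<in> point_ideal S" for u S
    using that by (cases S) auto
  then have "(fst g, - snd g) \<otimes>\<^bsub>R\<^esub> (fst h, - snd h) \<in>
      point_ideal (point_neg P) \<star> point_ideal (point_neg Q)"
    using prod by (intro ideal_prod.prod)
  then show ?case
    by (cases g; cases h) (simp add: algebra_simps)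
next
  case (sum g h)
  from ideal_prod.sum[OF sum.IH] show ?case
    by (cases g; cases h) simp
qed

text \<open>Multiplied by its conjugate, \<open>h\<close> lands in the product of the ideals of
  \<open>P\<close>, \<open>-P\<close>, \<open>Q\<close> and \<open>-Q\<close>, which
  \<open>vertical P * vertical Q\<close> generates.\<close>

lemma norm_dvd:
  assumes P: "P \<in> curve_points a" and Q: "Q \<in> curve_points a"
    and "h \<in> point_ideal P \<star> point_ideal Q"
  shows "vertical P * vertical Q dvd fst h ^ 2 - F * snd h ^ 2"
proof -
  let ?I = point_ideal
  have [simp]: "ideal (?I P) R" "ideal (?I Q) R" "ideal (?I (point_neg P)) R" "ideal (?I (point_neg Q)) R"
    using P Q by auto
  have "h \<otimes>\<^bsub>R\<^esub> (fst h, - snd h) \<in>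
      (?I P \<star> ?I Q) \<star> (?I (point_neg P) \<star> ?I (point_neg Q))"
    using assms conj_in_ideal_prod by (intro ideal_prod.prod)
  also have "\<dots> = (?I P \<star> ?I (point_neg P)) \<star> (?I Q \<star> ?I (point_neg Q))"
    by (rule ideal_prod_swap) simp_all
  also have "\<dots> = pidl (vertical P * vertical Q, 0)"
    unfolding point_ideal_prod_neg[OF P] point_ideal_prod_neg[OF Q] PIdl_prod_PIdl by simp
  finally have "vertical P * vertical Q dvd fst (h \<otimes>\<^bsub>R\<^esub> (fst h, - snd h))"
    unfolding in_PIdl_poly by simp
  also have "fst (h \<otimes>\<^bsub>R\<^esub> (fst h, - snd h)) = fst h ^ 2 - F * snd h ^ 2"
    by (cases h) (simp add: power2_eq_square)
  finally show ?thesis .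
qed

text \<open>A generator has norm of degree at most \<open>2\<close>, and norms of elements outside \<open>K[x]\<close> have degree at
  least \<open>3\<close>, so it is a polynomial in \<open>x\<close>.\<close>

lemma principal_point_ideal_prod:
  assumes P: "P \<in> curve_points a" and Q: "Q \<in> curve_points a"
    and h: "point_ideal P \<star> point_ideal Q = pidl h"
  shows "Q = point_neg P"
proof -
  let ?I = point_ideal
  let ?N = "\<lambda>h. fst h ^ 2 - F * snd h ^ 2"
  define V where "V = vertical P * vertical Q"
  have V: "V \<noteq> 0" "degree V \<le> 2"
    using degree_mult_le[of "vertical P" "vertical Q"] degree_vertical_le[of P] degree_vertical_le[of Q]
    by (auto simp: V_def vertical_nz)
  have [simp]: "ideal (?I P) R" "ideal (?I Q) R" "ideal (?I (point_neg P)) R" "ideal (?I (point_neg Q)) R"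
    using P Q by auto
  have h_in: "h \<in> ?I P \<star> ?I Q"
    unfolding h by (rule R.cgenideal_self) simp
  have "pidl h \<star> (?I (point_neg P) \<star> ?I (point_neg Q)) =
      (?I P \<star> ?I (point_neg P)) \<star> (?I Q \<star> ?I (point_neg Q))"
    unfolding h[symmetric] by (rule ideal_prod_swap) simp_all
  also have "\<dots> = pidl (V, 0)"
    unfolding point_ideal_prod_neg[OF P] point_ideal_prod_neg[OF Q] PIdl_prod_PIdl by (simp add: V_def)
  finally have hV: "pidl h \<star> (?I (point_neg P) \<star> ?I (point_neg Q)) = pidl (V, 0)" .
  have "(V, 0) \<in> pidl (V, 0)"
    by (rule R.cgenideal_self) simp
  then obtain k where k: "k \<in> ?I (point_neg P) \<star> ?I (point_neg Q)" "(V, 0) = h \<otimes>\<^bsub>R\<^esub> k"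
    unfolding hV[symmetric] PIdl_prod[OF R.ideal_prod_is_ideal[OF \<open>ideal (?I (point_neg P)) R\<close> \<open>ideal (?I (point_neg Q)) R\<close>]]
    by blast
  have "vertical (point_neg S) = vertical S" for S
    by (cases S) (simp_all add: vertical_def)
  \<comment> \<open>Both norms are multiples of \<open>V\<close> and their product is
    \<open>V^2\<close>, so the cofactors are constants.\<close>
  then have "V dvd ?N k" "V dvd ?N h"
    using norm_dvd[OF _ _ k(1)] norm_dvd[OF P Q h_in] P Q by (simp_all add: V_def)
  then obtain c d where cd: "?N h = V * c" "?N k = V * d"
    by blast
  have "?N h * ?N k = V ^ 2"
    using coord_ring_norm[OF k(2)[symmetric]] by simp
  then have "V ^ 2 * (c * d) = V ^ 2 * 1"
    unfolding cd by (simp add: power2_eq_square mult_ac)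
  then have "c * d = 1"
    using V(1) by (simp only: mult_cancel_left) simp
  then have "c \<noteq> 0" "d \<noteq> 0" "degree (c * d) = 0"
    by auto
  then have "degree c = 0"
    by (simp add: degree_mult_eq)
  then have deg: "degree (?N h) = degree V"
    using V \<open>c \<noteq> 0\<close> by (simp add: cd degree_mult_eq)
  then have snd_h: "snd h = 0"
    using degree_norm(1)[of F "snd h" "fst h"] V(2) degree_F by (cases "snd h = 0") auto
  then have deg_V: "degree V = 2 * degree (fst h)"
    using deg by (cases "fst h = 0") (auto simp: degree_power_eq)
  show ?thesis
  proof (cases "P = Infinity \<or> Q = Infinity")
    case True
    then have "P = Infinity \<and> Q = Infinity \<or> degree V = 1"
      by (cases P; cases Q) (simp_all add: V_def vertical_def)
    then show ?thesis
      using deg_V by auto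
  next
    case False
    then obtain x1 y1 x2 y2 where PQ: "P = Affine x1 y1" "Q = Affine x2 y2"
      by (metis point.exhaust)
    have "h \<in> ?I P \<inter> ?I Q"
      using h_in R.ideal_prod_inter[OF \<open>ideal (?I P) R\<close> \<open>ideal (?I Q) R\<close>] by blast
    then have roots: "poly (fst h) x1 = 0" "poly (fst h) x2 = 0"
      by (simp_all add: PQ snd_h)
    have "degree V = 2"
      by (simp add: V_def vertical_def PQ degree_mult_eq)
    then have deg1: "degree (fst h) = 1"
      using deg_V by simp
    then have "card {x. poly (fst h) x = 0} \<le> 1" "finite {x. poly (fst h) x = 0}"
      using card_poly_roots_bound[of "fst h"] poly_roots_finite[of "fst h"] by force+
    then have "x1 = x2"
      using roots by (simp add: card_le_Suc0_iff_eq)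
    then have "a * y1 ^ 2 = a * y2 ^ 2"
      using P Q by (simp add: PQ)
    then have "y2 = y1 \<or> y2 = - y1"
      using a_nz by (auto simp: power2_eq_iff)
    moreover have "y1 = 0" if "y2 = y1"
    proof -
      \<comment> \<open>If \<open>P = Q\<close>, the ideal contains \<open>(y - y1)^2\<close>, whose
        coefficient \<open>-2 y1\<close> at \<open>y\<close> is then divisible by a polynomial of
        degree 1.\<close>
      have "([:- y1:], 1) \<otimes>\<^bsub>R\<^esub> ([:- y1:], 1) \<in> ?I P \<star> ?I Q"
        by (intro ideal_prod.prod) (simp_all add: PQ \<open>x1 = x2\<close> that)
      moreover have "([:- y1:], 1) \<otimes>\<^bsub>R\<^esub> ([:- y1:], 1) = ([:y1 * y1:] + F, [:- 2 * y1:])"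
        by simp
      moreover have "h = (fst h, 0)"
        by (simp add: snd_h prod_eq_iff)
      ultimately have "([:y1 * y1:] + F, [:- 2 * y1:]) \<in> pidl (fst h, 0)"
        using h by metis
      then have "fst h dvd [:- 2 * y1:]"
        by (simp only: in_PIdl_poly snd_conv)
      then have "[:- 2 * y1:] = 0"
        using deg1 dvd_imp_degree_le[of "fst h" "[:- 2 * y1:]"] by auto
      then show ?thesis
        using two by simp
    qed
    ultimately show ?thesis
      using \<open>x1 = x2\<close> by (auto simp: PQ)
  qed
qed

text \<open>Multiplying by the ideal of \<open>-P\<close> shows that the product of the ideals of
  \<open>Q\<close> and \<open>-P\<close> is principal, which forces \<open>-P = -Q\<close>.\<close>

lemma point_ideal_equiv_imp_eq:
  assumes P: "P \<in> curve_points a" and Q: "Q \<in> curve_points a"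
    and "ideal_equiv (point_ideal P) (point_ideal Q)"
  shows "P = Q"
proof -
  let ?I = point_ideal
  let ?K = "?I Q \<star> ?I (point_neg P)"
  have [simp]: "ideal (?I P) R" "ideal (?I Q) R" "ideal (?I (point_neg P)) R"
    using P Q by auto
  then have K: "ideal ?K R"
    by (intro R.ideal_prod_is_ideal)
  obtain f g where fg: "f \<noteq> (0, 0)" "g \<noteq> (0, 0)" "pidl f \<star> ?I P = pidl g \<star> ?I Q"
    using assms(3) by (auto simp: ideal_equiv_def)
  have "pidl (f \<otimes>\<^bsub>R\<^esub> (vertical P, 0)) = pidl f \<star> (?I P \<star> ?I (point_neg P))"
    unfolding point_ideal_prod_neg[OF P] PIdl_prod_PIdl ..
  also have "\<dots> = pidl g \<star> ?K"
    by (simp add: R.ideal_prod_assoc[symmetric] fg)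
  finally have eq: "pidl g \<star> ?K = pidl (f \<otimes>\<^bsub>R\<^esub> (vertical P, 0))"
    by simp
  have "f \<otimes>\<^bsub>R\<^esub> (vertical P, 0) \<in> pidl (f \<otimes>\<^bsub>R\<^esub> (vertical P, 0))"
    by (rule R.cgenideal_self) simp
  then obtain h where "f \<otimes>\<^bsub>R\<^esub> (vertical P, 0) = g \<otimes>\<^bsub>R\<^esub> h"
    unfolding eq[symmetric] PIdl_prod[OF K] by blast
  then have "pidl g \<star> ?K = pidl g \<star> pidl h"
    unfolding eq PIdl_prod_PIdl by simp
  then have "?K = pidl h"
    by (rule PIdl_prod_cancel[OF K ideal_PIdl fg(2)])
  from principal_point_ideal_prod[OF Q _ this] have "point_neg P = point_neg Q"
    using P by simp
  then show ?thesis
    by (metis point_neg_point_neg)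
qed

text \<open>Both sums have ideals in the class of the product of the three point ideals, and a point
  is determined by its class.\<close>

lemma point_add_assoc:
  assumes P: "P \<in> curve_points a" and Q: "Q \<in> curve_points a" and S: "S \<in> curve_points a"
  shows "point_add a (point_add a P Q) S = point_add a P (point_add a Q S)"
proof -
  let ?I = point_ideal and ?add = "point_add a"
  note closed = point_add_closed[OF two a_nz]
  have PQ: "?add P Q \<in> curve_points a" and QS: "?add Q S \<in> curve_points a"
    using assms closed by auto
  have [simp]: "ideal (?I P) R" "ideal (?I Q) R" "ideal (?I S) R" "ideal (?I (?add P Q)) R"
    "ideal (?I (?add Q S)) R" "ideal (?I (?add (?add P Q) S)) R" "ideal (?I (?add P (?add Q S))) R"
    using assms PQ QS closed by auto
  have eq1: "ideal_equiv (?I (?add (?add P Q) S)) (?I (?add P Q) \<star> ?I S)"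
    by (rule ideal_equiv_sym[OF point_ideal_prod_equiv[OF PQ S]])
  have eq2: "ideal_equiv (?I (?add P Q) \<star> ?I S) (?I P \<star> ?I Q \<star> ?I S)"
    by (intro ideal_equiv_prod_right ideal_equiv_sym[OF point_ideal_prod_equiv[OF P Q]])
       (simp_all add: R.ideal_prod_is_ideal)
  have eq3: "ideal_equiv (?I P \<star> ?I Q \<star> ?I S) (?I P \<star> ?I (?add Q S))"
    unfolding R.ideal_prod_assoc[OF \<open>ideal (?I P) R\<close> \<open>ideal (?I Q) R\<close> \<open>ideal (?I S) R\<close>]
    by (intro ideal_equiv_prod_left point_ideal_prod_equiv[OF Q S])
       (simp_all add: R.ideal_prod_is_ideal)
  have eq4: "ideal_equiv (?I P \<star> ?I (?add Q S)) (?I (?add P (?add Q S)))"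
    by (rule point_ideal_prod_equiv[OF P QS])
  have "ideal_equiv (?I (?add (?add P Q) S)) (?I (?add P (?add Q S)))"
    by (rule ideal_equiv_trans[OF eq1 ideal_equiv_trans[OF eq2 ideal_equiv_trans[OF eq3 eq4]]])
       (simp_all add: R.ideal_prod_is_ideal)
  then show ?thesis
    using assms PQ QS closed by (intro point_ideal_equiv_imp_eq)
qed

lemma comm_group_mordell_weil: "comm_group (mordell_weil a)"
proof (rule comm_groupI)
  fix P Q S
  assume "P \<in> carrier (mordell_weil a)" "Q \<in> carrier (mordell_weil a)" "S \<in> carrier (mordell_weil a)"
  then have P: "P \<in> curve_points a" and Q: "Q \<in> curve_points a" and S: "S \<in> curve_points a"
    by (simp_all add: mordell_weil_def)
  show "P \<otimes>\<^bsub>mordell_weil a\<^esub> Q \<in> carrier (mordell_weil a)"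
    using point_add_closed[OF two a_nz P Q] by (simp add: mordell_weil_def)
  show "P \<otimes>\<^bsub>mordell_weil a\<^esub> Q \<otimes>\<^bsub>mordell_weil a\<^esub> S = P \<otimes>\<^bsub>mordell_weil a\<^esub> (Q \<otimes>\<^bsub>mordell_weil a\<^esub> S)"
    using point_add_assoc[OF P Q S] by (simp add: mordell_weil_def)
  show "P \<otimes>\<^bsub>mordell_weil a\<^esub> Q = Q \<otimes>\<^bsub>mordell_weil a\<^esub> P"
    using point_add_commute[OF P Q a_nz] by (simp add: mordell_weil_def)
  show "\<one>\<^bsub>mordell_weil a\<^esub> \<otimes>\<^bsub>mordell_weil a\<^esub> P = P"
    by (simp add: mordell_weil_def)
  show "\<exists>S\<in>carrier (mordell_weil a). S \<otimes>\<^bsub>mordell_weil a\<^esub> P = \<one>\<^bsub>mordell_weil a\<^esub>"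
    using P by (auto simp: mordell_weil_def point_add_neg_left intro!: bexI[of _ "point_neg P"])
qed (simp add: mordell_weil_def)

text \<open>The component of the \<open>2\<close>-descent map at the \<open>2\<close>-torsion point \<open>(e, 0)\<close>, with values in \<open>K\<^sup>* / (K\<^sup>*)\<^sup>2\<close>:
  in the Weierstrass coordinates \<open>X = a x\<close>, \<open>Y = a\<^sup>2 y\<close> it sends a point to \<open>X - a e\<close>, and \<open>(e, 0)\<close>
  to the product of the differences of \<open>a e\<close> with the other two roots, which is
  \<open>3 e\<^sup>2 - 1\<close> up to a square.\<close>

definition descent :: "'k \<Rightarrow> 'k point \<Rightarrow> 'k" where
  "descent e P = (case P of Infinity \<Rightarrow> 1
     | Affine x y \<Rightarrow> if x = e then 3 * e ^ 2 - 1 else a * (x - e))"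

section \<open>Square classes of collinear points\<close>

lemma descent_nz: "e ^ 3 = e \<Longrightarrow> descent e P \<noteq> 0"
  using two_torsion_deriv_nz a_nz by (auto simp: descent_def split: point.splits)

text \<open>The line passes through \<open>(e, 0)\<close>, so \<open>\<nu> = - l e\<close>. The
  product is the derivative at \<open>e\<close> of \<open>x^3 - x - a (l x + \<nu>)^2\<close>, whose
  last term has a double zero there.\<close>

lemma descent_collinear_torsion:
  assumes e: "e ^ 3 = e" and s1: "e + x2 + x3 = a * l ^ 2"
    and s2: "e * x2 + e * x3 + x2 * x3 = - 1 - 2 * a * l * \<nu>" and s3: "e * x2 * x3 = a * \<nu> ^ 2"
  shows "(x2 - e) * (x3 - e) = 3 * e ^ 2 - 1"
proof -
  have "a * (\<nu> + l * e) ^ 2 = a * \<nu> ^ 2 + e * (2 * a * l * \<nu>) + e ^ 2 * (a * l ^ 2)"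
    by (simp add: algebra_simps power2_eq_square)
  also have "2 * a * l * \<nu> = - 1 - (e * x2 + e * x3 + x2 * x3)"
    unfolding s2 by simp
  also have "a * \<nu> ^ 2 + e * (- 1 - (e * x2 + e * x3 + x2 * x3)) + e ^ 2 * (a * l ^ 2) = e ^ 3 - e"
    unfolding s1[symmetric] s3[symmetric] by (simp add: algebra_simps power2_eq_square power3_eq_cube)
  finally have "a * (\<nu> + l * e) ^ 2 = 0"
    using e by simp
  then have \<nu>: "\<nu> = - l * e"
    using a_nz by (simp add: eq_neg_iff_add_eq_0)
  have "(x2 - e) * (x3 - e) = (e * x2 + e * x3 + x2 * x3) - 2 * e * (e + x2 + x3) + 3 * e ^ 2"
    by (simp add: algebra_simps power2_eq_square)
  also have "\<dots> = 3 * e ^ 2 - 1"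
    unfolding s1 s2 \<nu> by (simp add: algebra_simps power2_eq_square)
  finally show ?thesis .
qed

text \<open>Evaluating the cubic at \<open>e\<close> gives
  \<open>(x1 - e) (x2 - e) (x3 - e) = a (l e + \<nu>)^2\<close>, and \<open>a^3\<close> times this
  is a square. If one abscissa is \<open>e\<close>, its factor \<open>3 e^2 - 1\<close> equals the
  product of the other two differences, and a square results again.\<close>

lemma descent_collinear:
  assumes e: "e ^ 3 = e" and s1: "x1 + x2 + x3 = a * l ^ 2"
    and s2: "x1 * x2 + x1 * x3 + x2 * x3 = - 1 - 2 * a * l * \<nu>" and s3: "x1 * x2 * x3 = a * \<nu> ^ 2"
  shows "\<exists>w. descent e (Affine x1 y1) * descent e (Affine x2 y2) * descent e (Affine x3 y3) = w ^ 2"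
proof -
  have torsion: "\<exists>w. descent e (Affine e y1) * descent e (Affine x2 y2) * descent e (Affine x3 y3) = w ^ 2"
    if "e + x2 + x3 = a * l ^ 2" "e * x2 + e * x3 + x2 * x3 = - 1 - 2 * a * l * \<nu>"
      "e * x2 * x3 = a * \<nu> ^ 2" for x2 x3 y1 y2 y3
  proof -
    note eq = descent_collinear_torsion[OF e that]
    then have "x2 \<noteq> e" "x3 \<noteq> e"
      using two_torsion_deriv_nz[OF e] by auto
    then have "descent e (Affine e y1) * descent e (Affine x2 y2) * descent e (Affine x3 y3) =
        (3 * e ^ 2 - 1) * a ^ 2 * ((x2 - e) * (x3 - e))"
      by (simp add: descent_def power2_eq_square)
    also have "\<dots> = (a * (3 * e ^ 2 - 1)) ^ 2"
      unfolding eq by (simp add: power2_eq_square)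
    finally show ?thesis
      by blast
  qed
  consider "x1 = e" | "x2 = e" | "x3 = e" | "x1 \<noteq> e" "x2 \<noteq> e" "x3 \<noteq> e"
    by blast
  then show ?thesis
  proof cases
    case 1
    then show ?thesis
      using torsion[of x2 x3 y1 y2 y3] s1 s2 s3 by simp
  next
    case 2
    then show ?thesis
      using torsion[of x1 x3 y2 y1 y3] s1 s2 s3 by (simp add: ac_simps)
  next
    case 3
    then show ?thesis
      using torsion[of x1 x2 y3 y1 y2] s1 s2 s3 by (simp add: ac_simps)
  next
    case 4
    have "(x1 - e) * (x2 - e) * (x3 - e) =
        x1 * x2 * x3 - e * (x1 * x2 + x1 * x3 + x2 * x3) + e ^ 2 * (x1 + x2 + x3) - e ^ 3"
      by (simp add: algebra_simps power2_eq_square power3_eq_cube)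
    also have "\<dots> = a * (\<nu> + l * e) ^ 2"
      unfolding s1 s2 s3 e by (simp add: algebra_simps power2_eq_square)
    finally have eq: "(x1 - e) * (x2 - e) * (x3 - e) = a * (\<nu> + l * e) ^ 2" .
    have "descent e (Affine x1 y1) * descent e (Affine x2 y2) * descent e (Affine x3 y3) =
        a ^ 3 * ((x1 - e) * (x2 - e) * (x3 - e))"
      using 4 by (simp add: descent_def power3_eq_cube)
    also have "\<dots> = (a ^ 2 * (\<nu> + l * e)) ^ 2"
      unfolding eq by (simp add: power2_eq_square power3_eq_cube)
    finally show ?thesis
      by blast
  qed
qed

text \<open>The homomorphism property modulo squares. Each square class is its own inverse, and
  \<open>descent\<close> ignores the ordinate, so the sum may stand for the third point of the
  line.\<close>

lemma descent_add:
  assumes e: "e ^ 3 = e" and P: "P \<in> curve_points a" and Q: "Q \<in> curve_points a"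
  shows "\<exists>w. descent e P * descent e Q * descent e (point_add a P Q) = w ^ 2"
proof (cases "P = Infinity \<or> Q = Infinity")
  case True
  then have "descent e P * descent e Q * descent e (point_add a P Q) = descent e (point_add a P Q) ^ 2"
    by (auto simp: descent_def power2_eq_square)
  then show ?thesis
    by blast
next
  case False
  then obtain x1 y1 x2 y2 where PQ: "P = Affine x1 y1" "Q = Affine x2 y2"
    by (metis point.exhaust)
  show ?thesis
  proof (cases "x1 = x2 \<and> y1 = - y2")
    case True
    then have "descent e P * descent e Q * descent e (point_add a P Q) = descent e P ^ 2"
      by (simp add: PQ descent_def power2_eq_square)
    then show ?thesis
      by blast
  next
    case False
    from P Q have "a * y1 ^ 2 = x1 ^ 3 - x1" "a * y2 ^ 2 = x2 ^ 3 - x2"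
      by (simp_all add: PQ)
    from point_add_line[OF two a_nz this False] show ?thesis
    proof cases
      case (1 l \<nu> x3)
      show ?thesis
        unfolding PQ 1(1) by (rule descent_collinear[OF e 1(4-6)])
    qed
  qed
qed

lemma two_torsion_cases:
  assumes P: "P \<in> curve_points a" and "point_add a P P = Infinity"
  obtains "P = Infinity" | "P = Affine 0 0" | "P = Affine 1 0" | "P = Affine (- 1) 0"
proof (cases P)
  case (Affine x y)
  then have "y = - y"
    using assms(2) by (auto simp: Let_def split: if_splits)
  then have "2 * y = 0"
    by (metis add.right_inverse mult_2)
  then have y: "y = 0"
    using two by simp
  then have "x * (x - 1) * (x + 1) = 0"
    using P Affine by (simp add: algebra_simps power3_eq_cube)
  then show thesis
    using that Affine y by (auto simp: eq_neg_iff_add_eq_0)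
qed

end

section \<open>Parity of valuations and points of order 2\<close>

locale int_valuation = twisted_curve +
  fixes v :: "'a \<Rightarrow> int"
  assumes v_mult: "x \<noteq> 0 \<Longrightarrow> y \<noteq> 0 \<Longrightarrow> v (x * y) = v x + v y"
begin

lemma v_1: "v 1 = 0"
  using v_mult[of 1 1] by simp

lemma v_minus_1: "v (- 1) = 0"
  using v_mult[of "- 1" "- 1"] v_1 by simp

lemma v_power: "x \<noteq> 0 \<Longrightarrow> v (x ^ n) = int n * v x"
  by (induction n) (simp_all add: v_1 v_mult algebra_simps)

lemma even_v_descent_add:
  assumes e: "e ^ 3 = e" and P: "P \<in> curve_points a" and Q: "Q \<in> curve_points a"
  shows "even (v (descent e (point_add a P Q)) + v (descent e P) + v (descent e Q))"
proof -
  obtain w where w: "descent e P * descent e Q * descent e (point_add a P Q) = w ^ 2"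
    using descent_add[OF assms] by blast
  then have "w \<noteq> 0"
    using descent_nz[OF e] by (metis mult_eq_0_iff zero_eq_power2)
  then have "v (descent e P * descent e Q * descent e (point_add a P Q)) = 2 * v w"
    unfolding w by (simp add: v_power)
  then have "v (descent e (point_add a P Q)) + v (descent e P) + v (descent e Q) = 2 * v w"
    using descent_nz[OF e] by (simp add: v_mult)
  then show ?thesis
    by simp
qed

text \<open>A double has descent values of even valuation, whereas each of the three points of order
  2 has a value \<open>a\<close> or \<open>-a\<close>, of odd valuation, at \<open>e = 0\<close> or
  \<open>e = 1\<close>.\<close>

lemma double_two_torsion_eq_Infinity:
  assumes "odd (v a)" and P: "P \<in> curve_points a"
    and tors: "point_add a (point_add a P P) (point_add a P P) = Infinity"
  shows "point_add a P P = Infinity"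
proof -
  have even: "even (v (descent e (point_add a P P)))" if "e ^ 3 = e" for e
    using even_v_descent_add[OF that P P] by simp
  have PP: "point_add a P P \<in> curve_points a"
    by (rule point_add_closed[OF two a_nz P P])
  have va: "v (a * - 1) = v a"
    using v_mult[of a "- 1"] a_nz v_minus_1 by simp
  show ?thesis
  proof (rule two_torsion_cases[OF PP tors])
    assume "point_add a P P = Affine 0 0"
    \<comment> \<open>The component \<open>e = 0\<close> cannot detect \<open>(0, 0)\<close>: its
      value there is \<open>-1\<close>, of valuation 0.\<close>
    then have "descent 1 (point_add a P P) = a * - 1"
      by (simp add: descent_def)
    then show ?thesis
      using even[of 1] va assms(1) by simp
  next
    assume "point_add a P P = Affine 1 0"
    then have "descent 0 (point_add a P P) = a"
      by (simp add: descent_def)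
    then show ?thesis
      using even[of 0] assms(1) by simp
  next
    assume "point_add a P P = Affine (- 1) 0"
    then have "descent 0 (point_add a P P) = a * - 1"
      by (simp add: descent_def)
    then show ?thesis
      using even[of 0] va assms(1) by simp
  qed
qed

end

text \<open>The first hypothesis says that \<open>h\<close> modulo 2 is a homomorphism; this extends
  it to integer combinations.\<close>

lemma (in comm_group) even_finprod:
  fixes h :: "'a \<Rightarrow> int"
  assumes h: "\<And>x y. x \<in> carrier G \<Longrightarrow> y \<in> carrier G \<Longrightarrow> even (h (x \<otimes> y) + h x + h y)"
    and "finite I" and "Q \<in> I \<rightarrow> carrier G"
  shows "even (h (\<Otimes>i\<in>I. Q i [^] c i) + (\<Sum>i\<in>I. c i * h (Q i)))"
proof -
  have one: "even (h \<one>)"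
    using h[of \<one> \<one>] by simp
  have nat_pow: "even (h (x [^] (m::nat)) + int m * h x)" if "x \<in> carrier G" for x m
  proof (induction m)
    case (Suc m)
    then show ?case
      using h[of "x [^] m" x] that by (auto simp: algebra_simps)
  qed (use one in simp)
  have inv: "even (h (inv x) + h x)" if "x \<in> carrier G" for x
    using h[of "inv x" x] one that by auto
  have int_pow: "even (h (x [^] m) + m * h x)" if "x \<in> carrier G" for x and m :: int
  proof (cases "m < 0")
    case True
    then have "x [^] m = inv (x [^] nat (- m))"
      by (simp only: int_pow_def2 if_True)
    then have "even (h (x [^] m) + h (x [^] nat (- m)))"
      using inv[of "x [^] nat (- m)"] that by simp
    moreover have "even (h (x [^] nat (- m)) + (- m) * h x)"
      using nat_pow[OF that, of "nat (- m)"] True by simp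
    ultimately show ?thesis
      by presburger
  next
    case False
    then have "x [^] m = x [^] nat m"
      by (simp only: int_pow_def2 if_False)
    then show ?thesis
      using nat_pow[OF that, of "nat m"] False by simp
  qed
  show ?thesis
    using assms(2,3)
  proof (induction I rule: finite_induct)
    case (insert i I)
    then have Q: "Q i \<in> carrier G" "Q \<in> I \<rightarrow> carrier G"
      by auto
    then have fin: "(\<Otimes>i\<in>I. Q i [^] c i) \<in> carrier G"
      by (intro finprod_closed) auto
    have "(\<Otimes>j\<in>insert i I. Q j [^] c j) = Q i [^] c i \<otimes> (\<Otimes>j\<in>I. Q j [^] c j)"
      using insert(1,2) Q by (intro finprod_insert) auto
    then have "even (h (\<Otimes>j\<in>insert i I. Q j [^] c j) + h (Q i [^] c i) + h (\<Otimes>j\<in>I. Q j [^] c j))"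
      using h[OF _ fin, of "Q i [^] c i"] Q by simp
    moreover have "even (h (\<Otimes>j\<in>I. Q j [^] c j) + (\<Sum>j\<in>I. c j * h (Q j)))"
      by (rule insert.IH[OF Q(2)])
    moreover have "even (h (Q i [^] c i) + c i * h (Q i))"
      by (rule int_pow[OF Q(1)])
    moreover have "(\<Sum>j\<in>insert i I. c j * h (Q j)) = c i * h (Q i) + (\<Sum>j\<in>I. c j * h (Q j))"
      using insert(1,2) by simp
    ultimately show ?case
      by presburger
  qed (use one in simp)
qed

text \<open>Infinite descent: coefficients of a relation can be halved again and again, so they are
  divisible by all powers of 2. The hypothesis \<open>even\<close> covers relations up to 2-torsion
  because a halved relation is at first known only up to 2-torsion.\<close>

lemma (in comm_group) int_lin_indep_by_descent:
  fixes Q :: "'i \<Rightarrow> 'a"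
  assumes "finite I" and Q: "Q \<in> I \<rightarrow> carrier G"
    and even: "\<And>(c :: 'i \<Rightarrow> int) i. (\<Otimes>i\<in>I. Q i [^] c i) \<otimes> (\<Otimes>i\<in>I. Q i [^] c i) = \<one> \<Longrightarrow> i \<in> I \<Longrightarrow> even (c i)"
    and double: "\<And>x. x \<in> carrier G \<Longrightarrow> (x \<otimes> x) \<otimes> (x \<otimes> x) = \<one> \<Longrightarrow> x \<otimes> x = \<one>"
  shows "int_lin_indep G I Q"
  unfolding int_lin_indep_def
proof (intro allI impI ballI)
  let ?S = "\<lambda>c :: 'i \<Rightarrow> int. \<Otimes>i\<in>I. Q i [^] c i"
  have closed: "?S c \<in> carrier G" for c
    using Q by (intro finprod_closed) auto
  have half: "?S c = ?S (\<lambda>i. c i div 2) \<otimes> ?S (\<lambda>i. c i div 2)" if "\<forall>i\<in>I. even (c i)" for c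
  proof -
    have "?S c = (\<Otimes>i\<in>I. Q i [^] (c i div 2) \<otimes> Q i [^] (c i div 2))"
      using Q that by (intro finprod_cong') (auto simp: int_pow_mult[symmetric] Pi_iff)
    also have "\<dots> = ?S (\<lambda>i. c i div 2) \<otimes> ?S (\<lambda>i. c i div 2)"
      using Q by (intro finprod_multf) auto
    finally show ?thesis .
  qed
  have power_dvd: "\<forall>i\<in>I. 2 ^ m dvd c i" if "?S c = \<one>" for m c
    using that
  proof (induction m arbitrary: c)
    case (Suc m)
    define d where "d = (\<lambda>i. c i div 2)"
    have c_even: "\<forall>i\<in>I. even (c i)"
      using even[of c] Suc.prems by simp
    then have "?S d \<otimes> ?S d = \<one>"
      using half[OF c_even] Suc.prems by (simp add: d_def)
    then have "\<forall>i\<in>I. even (d i)"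
      using even[of d] by blast
    \<comment> \<open>The halved combination is 2-torsion and has even coefficients again, so it is
      a double and vanishes by \<open>double\<close>.\<close>
    from half[OF this] \<open>?S d \<otimes> ?S d = \<one>\<close> have "?S d = \<one>"
      using double[OF closed[of "\<lambda>i. d i div 2"]] by simp
    then have "\<forall>i\<in>I. 2 ^ m dvd d i"
      by (rule Suc.IH)
    moreover have "c i = 2 * d i" if "i \<in> I" for i
      using c_even that by (simp add: d_def)
    ultimately show ?case
      by simp
  qed simp
  fix c :: "'i \<Rightarrow> int" and i
  assume "?S c = \<one>" "i \<in> I"
  show "c i = 0"
  proof (rule ccontr)
    assume "c i \<noteq> 0"
    then have "2 ^ nat \<bar>c i\<bar> \<le> \<bar>c i\<bar>"
      using power_dvd[OF \<open>?S c = \<one>\<close>] \<open>i \<in> I\<close> by (simp add: zdvd_imp_le)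
    moreover have "\<bar>c i\<bar> < 2 ^ nat \<bar>c i\<bar>"
      using of_nat_less_two_power[of "nat \<bar>c i\<bar>", where ?'a = int] by simp
    ultimately show False
      by simp
  qed
qed

section \<open>The Frobenius module\<close>

text \<open>Multiplication by a unit \<open>x\<close> permutes the units, so the factor
  \<open>x^(q - 1)\<close> leaves their product unchanged.\<close>

lemma finite_field_power_card:
  fixes x :: "'a::{field,finite}"
  shows "x ^ CARD('a) = x"
proof (cases "x = 0")
  case False
  let ?U = "UNIV - {0 :: 'a}"
  have bij: "bij_betw ((*) x) ?U ?U"
    by (rule bij_betw_byWitness[where f' = "\<lambda>y. y / x"]) (use False in auto)
  have "(\<Prod>y\<in>?U. y) = (\<Prod>y\<in>?U. x * y)"
    by (rule prod.reindex_bij_betw[OF bij, symmetric])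
  then have "x ^ card ?U * (\<Prod>y\<in>?U. y) = 1 * (\<Prod>y\<in>?U. y)"
    by (simp add: prod.distrib)
  moreover have "(\<Prod>y\<in>?U. y) \<noteq> 0"
    by (simp add: prod_zero_iff)
  ultimately have "x ^ card ?U = 1"
    by (metis mult_right_cancel)
  have "CARD('a) = Suc (card ?U)"
    by (metis card.remove finite UNIV_I)
  then have "x ^ CARD('a) = x * x ^ card ?U"
    by (metis power_Suc)
  then show ?thesis
    using \<open>x ^ card ?U = 1\<close> by (metis mult_1_right)
qed (simp add: zero_power zero_less_card_finite)

text \<open>\<open>(X + 1)^q - X^q - 1\<close> has degree below \<open>q\<close> and vanishes at all
  \<open>q\<close> field elements, so its coefficients are zero.\<close>

lemma of_nat_choose_card_eq_0:
  assumes "0 < j" "j < CARD('a)"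
  shows "of_nat (CARD('a) choose j) = (0 :: 'a::{field,finite})"
proof -
  let ?q = "CARD('a)"
  define P :: "'a poly" where "P = (\<Sum>j\<in>{0<..<?q}. monom (of_nat (?q choose j)) j)"
  have "poly P x = 0" for x
  proof -
    have "{..?q} = insert 0 (insert ?q {0<..<?q})"
      using zero_less_card_finite[where 'a = 'a] by auto
    then have "(x + 1) ^ ?q = 1 + (x ^ ?q + poly P x)"
      using zero_less_card_finite[where 'a = 'a]
      by (simp add: binomial_ring P_def poly_sum poly_monom)
    then show ?thesis
      by (simp add: finite_field_power_card)
  qed
  then have "?q \<le> degree P" if "P \<noteq> 0"
    using card_poly_roots_bound[OF that] by simp
  moreover have "degree P < ?q"
    unfolding P_def
    by (intro degree_sum_less le_less_trans[OF degree_monom_le]) (auto simp: zero_less_card_finite)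
  ultimately have "P = 0"
    by linarith
  moreover have "coeff P j = of_nat (?q choose j)"
    using assms by (simp add: P_def coeff_sum)
  ultimately show ?thesis
    by simp
qed

text \<open>The hypothesis says that the characteristic of \<open>'a\<close> also annihilates
  \<open>'b\<close>; below, \<open>'b\<close> is a polynomial ring or the algebraic closure.\<close>

lemma power_card_add:
  fixes x y :: "'b::comm_ring_1"
  assumes "\<And>n. of_nat n = (0 :: 'a::{field,finite}) \<Longrightarrow> of_nat n = (0 :: 'b)"
  shows "(x + y) ^ CARD('a) = x ^ CARD('a) + y ^ CARD('a)"
proof -
  let ?q = "CARD('a)"
  have "{..?q} = insert 0 (insert ?q {0<..<?q})"
    using zero_less_card_finite[where 'a = 'a] by auto
  moreover have "(\<Sum>j\<in>{0<..<?q}. of_nat (?q choose j) * x ^ j * y ^ (?q - j)) = 0"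
    using assms[OF of_nat_choose_card_eq_0] by (intro sum.neutral) simp
  ultimately show ?thesis
    using zero_less_card_finite[where 'a = 'a] by (simp add: binomial_ring add.commute)
qed

lemma power_card_add_poly:
  fixes P Q :: "'a::{field,finite} poly"
  shows "(P + Q) ^ CARD('a) = P ^ CARD('a) + Q ^ CARD('a)"
  by (rule power_card_add) (simp add: of_nat_poly)

lemma power_card_add_ac:
  fixes x y :: "'a::{field,finite} alg_closure"
  shows "(x + y) ^ CARD('a) = x ^ CARD('a) + y ^ CARD('a)"
  by (rule power_card_add) (metis to_ac_of_nat to_ac_0)

lemma power_card_sum_poly:
  fixes f :: "'b \<Rightarrow> 'a::{field,finite} poly"
  shows "(\<Sum>x\<in>A. f x) ^ CARD('a) = (\<Sum>x\<in>A. f x ^ CARD('a))"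
  by (induction A rule: infinite_finite_induct)
     (simp_all add: power_card_add_poly zero_power zero_less_card_finite)

lemma card_field_gt_1: "1 < CARD('a::{field,finite})"
  using card_mono[of UNIV "{0, 1 :: 'a}"] by simp

section \<open>The additive polynomials \<open>P(F)\<close>\<close>

lemma frob_poly_eq_sum:
  fixes P :: "'a::{field,finite} poly"
  assumes "degree P \<le> n"
  shows "frob_poly P = (\<Sum>j\<le>n. monom (coeff P j) (CARD('a) ^ j))"
  unfolding frob_poly_def
  by (rule sum.mono_neutral_left) (use assms in \<open>auto simp: coeff_eq_0\<close>)

lemma frob_poly_0 [simp]: "frob_poly 0 = 0"
  by (simp add: frob_poly_def)

text \<open>The \<open>q\<close>-th power is additive and fixes the coefficients, so it raises each
  exponent \<open>q^j\<close> to \<open>q^(j + 1)\<close>. This recursion drives the inductions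
  below.\<close>

lemma frob_poly_pCons:
  fixes P :: "'a::{field,finite} poly"
  shows "frob_poly (pCons c P) = monom c 1 + frob_poly P ^ CARD('a)"
proof -
  have "frob_poly (pCons c P) = (\<Sum>j\<le>Suc (degree P). monom (coeff (pCons c P) j) (CARD('a) ^ j))"
    by (rule frob_poly_eq_sum) (rule degree_pCons_le)
  also have "\<dots> = monom c 1 + (\<Sum>j\<le>degree P. monom (coeff P j) (CARD('a) ^ j) ^ CARD('a))"
    by (subst sum.atMost_Suc_shift) (simp add: monom_power finite_field_power_card mult.commute)
  also have "\<dots> = monom c 1 + frob_poly P ^ CARD('a)"
    by (simp add: frob_poly_def power_card_sum_poly)
  finally show ?thesis .
qed

lemma frob_poly_add: "frob_poly (P + Q) = frob_poly P + frob_poly Q"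
proof (induction P Q rule: poly_induct2)
  case (pCons a p b q)
  then show ?case
    by (simp add: frob_poly_pCons power_card_add_poly add_monom[symmetric] del: add_monom)
qed simp

lemma frob_poly_uminus: "frob_poly (- P) = - frob_poly P"
  using frob_poly_add[of P "- P"] by (simp add: eq_neg_iff_add_eq_0 add.commute)

lemma frob_poly_diff: "frob_poly (P - Q) = frob_poly P - frob_poly Q"
  using frob_poly_add[of P "- Q"] by (simp add: frob_poly_uminus)

lemma frob_poly_monom_mult:
  fixes P :: "'a::{field,finite} poly"
  shows "frob_poly (monom 1 k * P) = frob_poly P ^ (CARD('a) ^ k)"
proof (induction k)
  case (Suc k)
  have "monom 1 (Suc k) * P = pCons 0 (monom 1 k * P)"
    by (simp add: monom_Suc)
  then show ?case
    using Suc by (simp add: frob_poly_pCons power_mult[symmetric] mult.commute)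
qed simp

lemma degree_frob_poly:
  fixes P :: "'a::{field,finite} poly"
  assumes "P \<noteq> 0"
  shows "degree (frob_poly P) = CARD('a) ^ degree P \<and> frob_poly P \<noteq> 0"
  using assms
proof (induction P)
  case (pCons c P)
  show ?case
  proof (cases "P = 0")
    case True
    then show ?thesis
      using pCons.hyps by (simp add: frob_poly_pCons degree_monom_eq monom_eq_0_iff zero_power zero_less_card_finite)
  next
    case False
    then have deg: "degree (frob_poly P ^ CARD('a)) = CARD('a) ^ Suc (degree P)"
      using pCons.IH by (simp add: degree_power_eq)
    moreover have "degree (monom c 1) < CARD('a) ^ Suc (degree P)"
      using degree_monom_le[of c 1] one_less_power[OF card_field_gt_1, of "Suc (degree P)"]
      by (meson le_less_trans zero_less_Suc)
    ultimately have "degree (frob_poly (pCons c P)) = CARD('a) ^ Suc (degree P)"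
      by (simp add: frob_poly_pCons degree_add_eq_right)
    moreover from this have "frob_poly (pCons c P) \<noteq> 0"
      using zero_less_card_finite[where 'a = 'a] by auto
    ultimately show ?thesis
      using False by simp
  qed
qed simp

text \<open>As \<open>q\<close> is zero in the field, only the linear term survives
  differentiation.\<close>

lemma pderiv_frob_poly:
  fixes P :: "'a::{field,finite} poly"
  shows "pderiv (frob_poly P) = [:coeff P 0:]"
proof (cases P)
  case (pCons c P')
  have "of_nat CARD('a) = (0 :: 'a)"
    using of_nat_choose_card_eq_0[of 1, where 'a = 'a] card_field_gt_1[where 'a = 'a] by simp
  then have "pderiv (Z ^ CARD('a)) = 0" for Z :: "'a poly"
    by (simp add: pderiv_power)
  then show ?thesis
    by (simp add: pCons frob_poly_pCons pderiv_add pderiv_monom monom_0)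
qed

section \<open>The action on the algebraic closure\<close>

definition ac_poly :: "'a::field poly \<Rightarrow> 'a alg_closure poly" where
  "ac_poly P = map_poly to_ac P"

lemma coeff_ac_poly [simp]: "coeff (ac_poly P) j = to_ac (coeff P j)"
  by (simp add: ac_poly_def coeff_map_poly)

lemma ac_poly_0 [simp]: "ac_poly 0 = 0"
  by (simp add: ac_poly_def)

lemma ac_poly_eq_0_iff [simp]: "ac_poly P = 0 \<longleftrightarrow> P = 0"
  by (simp add: poly_eq_iff)

lemma ac_poly_pCons [simp]: "ac_poly (pCons c P) = pCons (to_ac c) (ac_poly P)"
  by (rule poly_eqI) (simp add: coeff_pCons split: nat.splits)

lemma ac_poly_1 [simp]: "ac_poly 1 = 1"
  by (simp add: one_pCons)

lemma ac_poly_add: "ac_poly (P + Q) = ac_poly P + ac_poly Q"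
  by (rule poly_eqI) simp

lemma ac_poly_mult: "ac_poly (P * Q) = ac_poly P * ac_poly Q"
  by (rule poly_eqI) (simp add: coeff_mult to_ac_sum)

lemma ac_poly_power: "ac_poly (P ^ n) = ac_poly P ^ n"
  by (induction n) (simp_all add: ac_poly_mult)

lemma degree_ac_poly [simp]: "degree (ac_poly P) = degree P"
  by (simp add: ac_poly_def degree_map_poly)

lemma pderiv_ac_poly: "pderiv (ac_poly P) = ac_poly (pderiv P)"
  by (rule poly_eqI) (simp add: coeff_pderiv)

text \<open>The module structure in which \<open>t\<close> acts as the \<open>q\<close>-power
  Frobenius; by \<open>frob_act_mult\<close>, products of polynomials act by composition.\<close>

definition frob_act :: "'a::{field,finite} poly \<Rightarrow> 'a alg_closure \<Rightarrow> 'a alg_closure" where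
  "frob_act P \<theta> = poly (ac_poly (frob_poly P)) \<theta>"

lemma frob_act_0 [simp]: "frob_act 0 \<theta> = 0"
  by (simp add: frob_act_def)

lemma frob_act_pCons:
  fixes P :: "'a::{field,finite} poly"
  shows "frob_act (pCons c P) \<theta> = to_ac c * \<theta> + frob_act P \<theta> ^ CARD('a)"
  by (simp add: frob_act_def frob_poly_pCons ac_poly_add ac_poly_power monom_Suc monom_0)

lemma frob_act_1 [simp]: "frob_act 1 \<theta> = \<theta>"
  by (simp add: one_pCons frob_act_pCons zero_power zero_less_card_finite)

lemma frob_act_add: "frob_act (P + Q) \<theta> = frob_act P \<theta> + frob_act Q \<theta>"
  by (simp add: frob_act_def frob_poly_add ac_poly_add)

lemma frob_act_add_right: "frob_act P (\<theta> + \<eta>) = frob_act P \<theta> + frob_act P \<eta>"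
  by (induction P) (simp_all add: frob_act_pCons power_card_add_ac algebra_simps)

lemma frob_act_zero_right [simp]: "frob_act P 0 = 0"
  using frob_act_add_right[of P 0 0] by (metis add.right_neutral add_left_cancel)

lemma frob_act_smult: "frob_act (smult c P) \<theta> = to_ac c * frob_act P \<theta>"
proof (induction P)
  case (pCons a P)
  have "to_ac c ^ CARD('a) = to_ac c"
    by (metis finite_field_power_card to_ac_power)
  then show ?case
    using pCons.IH by (simp add: frob_act_pCons power_mult_distrib algebra_simps)
qed simp

lemma frob_act_mult: "frob_act (P * Q) \<theta> = frob_act P (frob_act Q \<theta>)"
proof (induction P)
  case (pCons c P)
  then show ?case
    by (simp add: frob_act_pCons frob_act_add frob_act_smult)
qed simp

lemma order_frob_poly_eq_0:
  assumes "frob_act D \<theta> \<noteq> 0"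
  shows "order \<theta> (ac_poly (frob_poly D)) = 0"
  using assms by (simp add: frob_act_def order_0I)

text \<open>If \<open>D(0) \<noteq> 0\<close> then \<open>D(F)\<close> has constant non-zero derivative, hence simple roots; a factor
  \<open>t\<close> of \<open>D\<close> multiplies all multiplicities by \<open>q\<close>.\<close>

lemma odd_order_frob_poly:
  fixes D :: "'a::{field,finite} poly"
  assumes "odd CARD('a)" and "D \<noteq> 0" and "frob_act D \<theta> = 0"
  shows "odd (order \<theta> (ac_poly (frob_poly D)))"
  using assms(2,3)
proof (induction D)
  case (pCons c P)
  have nz: "ac_poly (frob_poly (pCons c P)) \<noteq> 0"
    using degree_frob_poly[of "pCons c P"] pCons.hyps by simp
  show ?case
  proof (cases "c = 0")
    case True
    then have "P \<noteq> 0" "frob_act P \<theta> = 0"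
      using pCons by (simp_all add: frob_act_pCons)
    moreover have "order \<theta> (Z ^ n) = n * order \<theta> Z" if "Z \<noteq> 0" for Z and n
      using that by (induction n) (simp_all add: order_mult)
    ultimately show ?thesis
      using True assms(1) pCons.IH degree_frob_poly[of P]
      by (simp add: frob_poly_pCons ac_poly_power)
  next
    case False
    let ?p = "ac_poly (frob_poly (pCons c P))"
    have "\<not> [:- \<theta>, 1:] ^ 2 dvd ?p"
    proof
      assume "[:- \<theta>, 1:] ^ 2 dvd ?p"
      then obtain r where "?p = [:- \<theta>, 1:] ^ 2 * r"
        by blast
      then have r: "?p = [:- \<theta>, 1:] * ([:- \<theta>, 1:] * r)"
        by (simp only: power2_eq_square mult.assoc)
      have "poly (pderiv ?p) \<theta> = 0"
        unfolding r by (simp only: pderiv_mult) simp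
      then show False
        using False by (simp add: pderiv_ac_poly pderiv_frob_poly)
    qed
    then have "order \<theta> ?p < 2"
      using nz by (simp add: order_divides)
    moreover have "order \<theta> ?p \<noteq> 0"
      using nz pCons.prems(2) by (simp add: order_eq_0_iff frob_act_def)
    ultimately show ?thesis
      by (simp add: less_2_cases_iff)
  qed
qed simp

section \<open>Points with prescribed annihilator\<close>

lemma poly_bezout:
  fixes P Q :: "'a::field poly"
  shows "\<exists>U V. U * P + V * Q dvd P \<and> U * P + V * Q dvd Q"
\<comment> \<open>The measure of Euclid's algorithm must separate \<open>Q = 0\<close> from a
  nonzero constant, since both have degree 0.\<close>
proof (induction "if Q = 0 then 0 else Suc (degree Q)" arbitrary: P Q rule: less_induct)
  case less
  show ?case
  proof (cases "Q = 0")
    case True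
    then show ?thesis
      by (intro exI[of _ 1] exI[of _ 0]) simp
  next
    case False
    have "\<exists>U V. U * Q + V * (P mod Q) dvd Q \<and> U * Q + V * (P mod Q) dvd P mod Q"
      using False degree_mod_less[of Q P] by (intro less) auto
    then obtain U V where UV: "U * Q + V * (P mod Q) dvd Q" "U * Q + V * (P mod Q) dvd P mod Q"
      by blast
    have "U * Q + V * (P mod Q) = V * P + (U - V * (P div Q)) * Q"
      by (simp add: minus_div_mult_eq_mod[symmetric] algebra_simps)
    moreover have "U * Q + V * (P mod Q) dvd P"
      using UV by (metis dvd_mod_iff)
    ultimately show ?thesis
      using UV(1) by (metis)
  qed
qed

text \<open>The divisor \<open>R\<close> of least degree plays the role of a prime factor of \<open>C\<close>.\<close>

lemma obtain_minimal_divisor: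
  fixes C :: "'a::field poly"
  assumes "C \<noteq> 0" "degree C > 0"
  obtains R where "R dvd C" "degree R > 0" "\<And>E. R dvd E \<or> (\<exists>U V. U * E + V * R = 1)"
proof -
  define R where "R = arg_min degree (\<lambda>R. R dvd C \<and> degree R > 0)"
  have R: "R dvd C" "degree R > 0" and min: "\<And>S. S dvd C \<Longrightarrow> degree S > 0 \<Longrightarrow> degree R \<le> degree S"
    using arg_min_nat_lemma[of "\<lambda>R. R dvd C \<and> degree R > 0" C degree] assms
    by (auto simp: R_def)
  have "R dvd E \<or> (\<exists>U V. U * E + V * R = 1)" for E
  proof -
    obtain U V where UV: "U * E + V * R dvd E" "U * E + V * R dvd R"
      using poly_bezout by blast
    let ?D = "U * E + V * R"
    have D: "?D dvd C" "?D \<noteq> 0"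
      using dvd_trans[OF UV(2) R(1)] UV(2) R(2) by auto
    show ?thesis
    proof (cases "degree ?D > 0")
      case True
      obtain S where S: "R = ?D * S"
        using UV(2) by blast
      then have "S \<noteq> 0"
        using R(2) by auto
      then have "degree R = degree ?D + degree S"
        using S D(2) by (metis degree_mult_eq)
      then have "degree S = 0"
        using min[OF D(1) True] by simp
      then obtain s where "S = [:s:]" "s \<noteq> 0"
        using \<open>S \<noteq> 0\<close> by (metis degree_eq_zeroE pCons_0_0)
      then have "?D = R * [:inverse s:]"
        by (subst S) simp
      then have "R dvd E"
        using UV(1) by (metis dvd_mult_left)
      then show ?thesis ..
    next
      case False
      then obtain d where d: "?D = [:d:]" "d \<noteq> 0"
        using D(2) by (metis degree_eq_zeroE neq0_conv pCons_0_0)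
      have "smult (inverse d) U * E + smult (inverse d) V * R = smult (inverse d) ?D"
        by (simp add: smult_add_right)
      also have "\<dots> = 1"
        using d by (simp add: one_pCons)
      finally show ?thesis
        by blast
    qed
  qed
  then show thesis
    using that R by blast
qed

text \<open>\<open>R(F)\<close> is \<open>t\<close> times a polynomial \<open>H\<close> of positive
  degree with \<open>H(0) = R(0)\<close>, so any root of \<open>H\<close> is a nonzero element of
  the kernel.\<close>

lemma frob_act_kernel_nontrivial:
  fixes R :: "'a::{field,finite} poly"
  assumes "degree R > 0" "coeff R 0 \<noteq> 0"
  obtains \<eta> where "\<eta> \<noteq> 0" "frob_act R \<eta> = 0"
proof -
  let ?p = "ac_poly (frob_poly R)"
  have "poly ?p 0 = 0"
    using frob_act_zero_right[of R] by (simp add: frob_act_def)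
  then obtain H where H: "?p = pCons 0 H"
    by (cases ?p) auto
  have "R \<noteq> 0"
    using assms(1) by auto
  then have "degree ?p = CARD('a) ^ degree R"
    using degree_frob_poly[OF \<open>R \<noteq> 0\<close>] by simp
  then have "degree ?p > 1"
    using one_less_power[OF card_field_gt_1 assms(1)] by simp
  then have "degree H > 0"
    unfolding H by (auto split: if_splits)
  then obtain \<eta> where \<eta>: "poly H \<eta> = 0"
    using alg_closed_imp_poly_has_root by blast
  have "coeff H 0 = coeff (pderiv ?p) 0"
    unfolding H by (simp add: coeff_pderiv)
  also have "\<dots> = to_ac (coeff R 0)"
    by (simp add: pderiv_ac_poly pderiv_frob_poly)
  finally have "poly H 0 \<noteq> 0"
    using assms(2) by (simp add: poly_0_coeff_0)
  then have "\<eta> \<noteq> 0"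
    using \<eta> by auto
  moreover have "frob_act R \<eta> = 0"
    using \<eta> by (simp add: frob_act_def H)
  ultimately show thesis
    using that by blast
qed

lemma frob_act_surj:
  fixes R :: "'a::{field,finite} poly"
  assumes "R \<noteq> 0"
  obtains \<theta> where "frob_act R \<theta> = \<theta>'"
proof -
  let ?p = "ac_poly (frob_poly R)"
  have "degree ?p > 0"
    using degree_frob_poly[OF assms] zero_less_card_finite[where 'a = 'a] by simp
  then have "degree (?p + [:- \<theta>':]) > 0"
    by (subst degree_add_eq_left) auto
  then obtain \<theta> where "poly (?p + [:- \<theta>':]) \<theta> = 0"
    using alg_closed_imp_poly_has_root by blast
  then show thesis
    using that[of \<theta>] by (simp add: frob_act_def)
qed

text \<open>Up to powers of \<open>t\<close>, which act injectively, \<open>\<theta>\<close> has annihilator \<open>(C)\<close>.\<close>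

lemma frob_act_annihilator:
  fixes C :: "'a::{field,finite} poly"
  assumes "C \<noteq> 0"
  shows "\<exists>\<theta>. frob_act C \<theta> = 0 \<and> (\<forall>D. frob_act D \<theta> = 0 \<longrightarrow> (\<exists>m. C dvd monom 1 m * D))"
  using assms
proof (induction "degree C" arbitrary: C rule: less_induct)
  case less
  show ?case
  proof (cases "degree C = 0")
    case True
    then have "C dvd D" for D
      using less.prems by (metis degree_eq_zeroE is_unit_pCons_iff pCons_0_0 unit_imp_dvd)
    then show ?thesis
      by (intro exI[of _ 0]) simp
  next
    case False
    then obtain R where R: "R dvd C" "degree R > 0" "\<And>E. R dvd E \<or> (\<exists>U V. U * E + V * R = 1)"
      using obtain_minimal_divisor[OF less.prems] by blast
    then obtain C' where C: "C = R * C'"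
      by blast
    then have nz: "R \<noteq> 0" "C' \<noteq> 0"
      using less.prems by auto
    then have "degree C' < degree C"
      using R(2) by (simp add: C degree_mult_eq)
    then obtain \<theta>' where \<theta>': "frob_act C' \<theta>' = 0"
      "\<And>D. frob_act D \<theta>' = 0 \<Longrightarrow> \<exists>m. C' dvd monom 1 m * D"
      using less.hyps nz(2) by blast
    show ?thesis
    proof (cases "R dvd monom 1 1")
      \<comment> \<open>A factor \<open>t\<close> of \<open>C\<close> is absorbed by raising the
        exponent, so \<open>\<theta>'\<close> serves unchanged.\<close>
      case True
      have "\<exists>m. C dvd monom 1 m * D" if "frob_act D \<theta>' = 0" for D
      proof -
        obtain m where "C' dvd monom 1 m * D"
          using \<theta>'(2)[OF \<open>frob_act D \<theta>' = 0\<close>] by blast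
        then have "C dvd monom 1 1 * (monom 1 m * D)"
          unfolding C by (intro mult_dvd_mono True)
        also have "monom 1 1 * (monom 1 m * D) = monom 1 (Suc m) * D"
          by (simp add: mult_monom flip: mult.assoc)
        finally show ?thesis
          by blast
      qed
      moreover have "frob_act C \<theta>' = 0"
        by (simp add: C frob_act_mult \<theta>'(1))
      ultimately show ?thesis
        by blast
    next
      case False
      then obtain U V where UV: "U * monom 1 1 + V * R = 1"
        using R(3) by blast
      \<comment> \<open>\<open>t\<close> is invertible modulo \<open>R\<close>, with inverse
        \<open>U\<close>.\<close>
      have cancel_t: "R dvd E" if "R dvd monom 1 m * E" for m E
        using that
      proof (induction m)
        case (Suc m)
        have "monom 1 m * E = U * (monom 1 1 * (monom 1 m * E)) + R * (V * (monom 1 m * E))"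
          using arg_cong[OF UV, of "\<lambda>Z. Z * (monom 1 m * E)"] by (simp add: algebra_simps)
        also have "monom 1 1 * (monom 1 m * E) = monom 1 (Suc m) * E"
          by (simp add: mult_monom flip: mult.assoc)
        finally have "R dvd monom 1 m * E"
          using Suc.prems by (metis dvd_add dvd_mult dvd_triv_left)
        then show ?case
          by (rule Suc.IH)
      qed simp
      have "coeff R 0 \<noteq> 0"
      proof
        assume "coeff R 0 = 0"
        then have "poly R 0 = 0"
          by (simp add: poly_0_coeff_0)
        then have "poly (U * monom 1 1 + V * R) 0 = 0"
          by (simp add: poly_monom)
        then show False
          unfolding UV by simp
      qed
      then obtain \<eta> where \<eta>: "\<eta> \<noteq> 0" "frob_act R \<eta> = 0"
        using frob_act_kernel_nontrivial R(2) by blast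
      obtain \<theta>0 where \<theta>0: "frob_act R \<theta>0 = \<theta>'"
        using frob_act_surj[OF nz(1)] by blast
      \<comment> \<open>Every preimage of \<open>\<theta>'\<close> under \<open>R\<close> is killed
        by \<open>C\<close>; one not killed by \<open>C'\<close> is wanted. If \<open>R\<close>
        divides \<open>C'\<close>, any preimage works by the annihilator property of
        \<open>\<theta>'\<close>. Otherwise \<open>C'\<close> is injective on the kernel of
        \<open>R\<close>, so \<open>\<theta>0\<close> or \<open>\<theta>0 + \<eta>\<close>
        works.\<close>
      obtain \<theta> where \<theta>: "frob_act R \<theta> = \<theta>'" "frob_act C' \<theta> \<noteq> 0"
      proof (cases "R dvd C'")
        case True
        then obtain C'' where C'': "C' = R * C''"
          by blast
        have "frob_act C' \<theta>0 = frob_act C'' \<theta>'"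
          unfolding C'' by (subst mult.commute) (simp add: frob_act_mult \<theta>0)
        moreover have "frob_act C'' \<theta>' \<noteq> 0"
        proof
          assume "frob_act C'' \<theta>' = 0"
          then obtain m where "R * C'' dvd monom 1 m * C''"
            using \<theta>'(2) C'' by blast
          then have "R dvd monom 1 m"
            using nz(2) C'' by simp
          then have "R dvd 1"
            using cancel_t[of m 1] by simp
          then show False
            using R(2) nz(1) dvd_imp_degree_le[of R 1] by simp
        qed
        ultimately show thesis
          using that \<theta>0 by simp
      next
        case False
        then obtain U' V' where UV': "U' * C' + V' * R = 1"
          using R(3) by blast
        have "frob_act C' \<eta> \<noteq> 0"
        proof
          assume "frob_act C' \<eta> = 0"
          then have "frob_act (U' * C' + V' * R) \<eta> = 0"
            by (simp add: frob_act_add frob_act_mult \<eta>(2))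
          then show False
            using \<eta>(1) by (simp add: UV')
        qed
        then consider "frob_act C' \<theta>0 \<noteq> 0" | "frob_act C' (\<theta>0 + \<eta>) \<noteq> 0"
          by (metis frob_act_add_right add_0)
        then show thesis
        proof cases
          case 2
          then show thesis
            using that[of "\<theta>0 + \<eta>"] by (simp add: frob_act_add_right \<theta>0 \<eta>(2))
        qed (use that \<theta>0 in blast)
      qed
      have "\<exists>m. C dvd monom 1 m * D" if D: "frob_act D \<theta> = 0" for D
      proof -
        have "frob_act D \<theta>' = frob_act R (frob_act D \<theta>)"
          unfolding \<theta>(1)[symmetric] frob_act_mult[symmetric] by (simp add: mult.commute)
        then obtain m E where E: "monom 1 m * D = C' * E"
          using \<theta>'(2)[of D] D by (auto elim!: dvdE)
        \<comment> \<open>Otherwise \<open>C'\<close> would be a combination of \<open>t^m D\<close>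
          and \<open>C' R\<close>, both of which kill \<open>\<theta>\<close>.\<close>
        have "R dvd E"
        proof (rule ccontr)
          assume "\<not> R dvd E"
          then obtain U' V' where UV': "U' * E + V' * R = 1"
            using R(3) by blast
          have "C' = U' * (monom 1 m * D) + V' * (C' * R)"
            using arg_cong[OF UV', of "\<lambda>Z. Z * C'"] unfolding E by (simp add: algebra_simps)
          then have "frob_act C' \<theta> = frob_act (U' * (monom 1 m * D) + V' * (C' * R)) \<theta>"
            by (rule arg_cong)
          also have "\<dots> = 0"
            by (simp add: frob_act_add frob_act_mult D \<theta>(1) \<theta>'(1))
          finally show False
            using \<theta>(2) by simp
        qed
        then have "C dvd monom 1 m * D"
          unfolding C E by (simp add: mult.commute mult_dvd_mono)
        then show ?thesis ..
      qed
      moreover have "frob_act C \<theta> = 0"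
        unfolding C by (subst mult.commute) (simp add: frob_act_mult \<theta>(1) \<theta>'(1))
      ultimately show ?thesis
        by blast
    qed
  qed
qed

section \<open>Linear independence\<close>

text \<open>The extension of an order function to the field of fractions. If \<open>f\<close> is
  additive on products, the choice of the fraction is immaterial for \<open>z\<close> nonzero; at
  zero the value is unspecified.\<close>

definition fract_ord :: "('b::idom \<Rightarrow> nat) \<Rightarrow> 'b fract \<Rightarrow> int" where
  "fract_ord f z = (SOME d. \<exists>p q. p \<noteq> 0 \<and> q \<noteq> 0 \<and> z = Fract p q \<and> d = int (f p) - int (f q))"

lemma fract_ord_Fract:
  assumes f: "\<And>p q. p \<noteq> 0 \<Longrightarrow> q \<noteq> 0 \<Longrightarrow> f (p * q) = f p + f q" and "p \<noteq> 0" "q \<noteq> 0"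
  shows "fract_ord f (Fract p q) = int (f p) - int (f q)"
  unfolding fract_ord_def
proof (rule some_equality)
  fix d assume "\<exists>p' q'. p' \<noteq> 0 \<and> q' \<noteq> 0 \<and> Fract p q = Fract p' q' \<and> d = int (f p') - int (f q')"
  then obtain p' q' where *: "p' \<noteq> 0" "q' \<noteq> 0" "Fract p q = Fract p' q'" "d = int (f p') - int (f q')"
    by blast
  then have "p * q' = p' * q"
    using assms by (simp add: eq_fract)
  then have "f p + f q' = f p' + f q"
    using f[of p q'] f[of p' q] assms * by simp
  then show "d = int (f p) - int (f q)"
    using * by linarith
qed (use assms in blast)

lemma fract_ord_mult:
  assumes f: "\<And>p q. p \<noteq> 0 \<Longrightarrow> q \<noteq> 0 \<Longrightarrow> f (p * q) = f p + f q" and "x \<noteq> 0" "y \<noteq> 0"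
  shows "fract_ord f (x * y) = fract_ord f x + fract_ord f y"
proof (cases x rule: Fract_cases_nonzero; cases y rule: Fract_cases_nonzero)
  fix p q r s
  assume "x = Fract p q" "q \<noteq> 0" "p \<noteq> 0" "y = Fract r s" "s \<noteq> 0" "r \<noteq> 0"
  then show ?thesis
    by (simp add: fract_ord_Fract[OF f] f)
qed (use assms in auto)

lemma fract_ord_to_fract:
  assumes f: "\<And>p q. p \<noteq> 0 \<Longrightarrow> q \<noteq> 0 \<Longrightarrow> f (p * q) = f p + f q" and "p \<noteq> 0"
  shows "fract_ord f (to_fract p) = int (f p)"
  using fract_ord_Fract[OF f, of p 1] f[of 1 1] assms(2) by (simp add: to_fract_def)

lemma to_fract_power: "to_fract (p ^ n) = to_fract p ^ n"
  by (induction n) simp_all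

text \<open>\<open>t\<close> is invertible modulo \<open>t^k - 1\<close>, because
  \<open>t^(k m)\<close> is congruent to 1.\<close>

lemma monom_minus_one_dvd_cancel:
  fixes P :: "'a::comm_ring_1 poly"
  assumes "0 < k" "monom 1 k - 1 dvd monom 1 m * P"
  shows "monom 1 k - 1 dvd P"
proof -
  have "monom 1 (k * m) = monom 1 (k * m - m) * (monom 1 m :: 'a poly)"
    using assms(1) by (simp add: mult_monom)
  then have "monom 1 k - 1 dvd monom 1 (k * m) * P"
    using assms(2) by (simp add: mult.assoc)
  moreover have "monom 1 k - 1 dvd (monom 1 (k * m) - 1 :: 'a poly)"
  proof (induction m)
    case (Suc m)
    have "monom 1 (k * Suc m) - 1 = monom 1 k * (monom 1 (k * m) - 1) + (monom 1 k - 1 :: 'a poly)"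
      by (simp add: mult_monom algebra_simps)
    then show ?case
      using Suc by (metis dvd_add dvd_mult dvd_refl)
  qed simp
  ultimately have "monom 1 k - 1 dvd monom 1 (k * m) * P - (monom 1 (k * m) - 1) * P"
    by (simp only: dvd_diff dvd_mult2)
  then show ?thesis
    by (simp add: algebra_simps)
qed

lemma degree_monom_minus_one:
  assumes "0 < k"
  shows "degree (monom 1 k - 1 :: 'a::comm_ring_1 poly) = k"
proof -
  have "degree (monom 1 k + - 1 :: 'a poly) = degree (monom 1 k :: 'a poly)"
    by (rule degree_add_eq_left) (use assms in \<open>simp add: degree_monom_eq\<close>)
  then show ?thesis
    by (simp add: degree_monom_eq)
qed

theorem theorem4p1:
  fixes A0 :: "'a::{field,finite} poly"
    and B :: "nat \<Rightarrow> 'a poly"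
    and k :: "nat \<Rightarrow> nat"
    and n q :: nat
    and A :: "'a poly fract"
    and \<beta> :: "nat \<Rightarrow> 'a poly fract"
    and Q :: "nat \<Rightarrow> 'a poly fract point"
  assumes "q = CARD('a)" and "q mod 4 = 3"
    and "inj_on k {1..n}"
    and "\<And>i. i \<in> {1..n} \<Longrightarrow> odd (k i) \<and> 0 < k i"
    and "A0 \<noteq> 0"
    and "\<And>i. i \<in> {1..n} \<Longrightarrow> A0 = (monom 1 (k i) - 1) * B i"
  defines "A \<equiv> to_fract (frob_poly A0)"
    and "\<beta> \<equiv> \<lambda>i. to_fract (frob_poly (B i))"
    and "Q \<equiv> \<lambda>i. Affine (\<beta> i ^ ((q ^ k i - 1) div 2)) (\<beta> i ^ ((q ^ k i - 3) div 4))"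
  shows "(\<forall>i\<in>{1..n}. Q i \<in> carrier (mordell_weil A)) \<and>
         int_lin_indep (mordell_weil A) {1..n} Q"
proof -
  note q = assms(1,2) and k = assms(3,4) and A0_nz = assms(5) and A0_eq = assms(6)
  let ?I = "{1..n}"
  define m where "m = (\<lambda>i. (q ^ k i - 1) div 2)"
  define j where "j = (\<lambda>i. (q ^ k i - 3) div 4)"
  have q_odd: "odd q"
    using q(2) by presburger
  \<comment> \<open>An odd power of \<open>q\<close> is again 3 modulo 4, so the integer divisions
    in the exponents are exact and \<open>m i\<close> is odd.\<close>
  have q_power: "q ^ k i = 4 * j i + 3" "m i = 2 * j i + 1" if i: "i \<in> ?I" for i
  proof -
    obtain l where l: "k i = 2 * l + 1"
      using k(2)[OF i] by (blast elim: oddE)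
    have "q ^ k i mod 4 = (q mod 4) ^ k i mod 4"
      by (simp add: power_mod)
    also have "\<dots> = 3 * 9 ^ l mod 4"
      unfolding q(2) l by (simp add: power_add power_mult)
    also have "\<dots> = 3"
      by (induction l) (simp_all, presburger)
    finally have mod: "q ^ k i mod 4 = 3" .
    then show "q ^ k i = 4 * j i + 3" "m i = 2 * j i + 1"
      unfolding j_def m_def by presburger+
  qed
  have B_nz: "B i \<noteq> 0" if "i \<in> ?I" for i
    using A0_eq[OF that] A0_nz by auto
  have A_nz: "A \<noteq> 0"
    using degree_frob_poly[OF A0_nz] by (simp add: A_def)
  have \<beta>_nz: "\<beta> i \<noteq> 0" if "i \<in> ?I" for i
    using degree_frob_poly[OF B_nz[OF that]] by (simp add: \<beta>_def)
  \<comment> \<open>Multiplication by \<open>t^k\<close> becomes the \<open>q^k\<close>-th power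
    under \<open>frob_poly\<close>, so the factor \<open>t^k - 1\<close> gives a difference.\<close>
  have A_eq: "A = \<beta> i ^ q ^ k i - \<beta> i" if "i \<in> ?I" for i
  proof -
    have "A0 = monom 1 (k i) * B i - B i"
      using A0_eq[OF that] by (simp add: algebra_simps)
    then have "frob_poly A0 = frob_poly (B i) ^ (q ^ k i) - frob_poly (B i)"
      unfolding q(1) by (simp only: frob_poly_diff frob_poly_monom_mult)
    then show ?thesis
      by (simp add: A_def \<beta>_def to_fract_power)
  qed
  have Q_eq: "Q i = Affine (\<beta> i ^ m i) (\<beta> i ^ j i)" for i
    by (simp add: Q_def m_def j_def)
  have Q_curve: "Q i \<in> curve_points A" if "i \<in> ?I" for i
  proof -
    \<comment> \<open>Both sides are \<open>\<beta>^(6 j + 3) - \<beta>^(2 j + 1)\<close>.\<close>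
    have "(\<beta> i ^ (4 * j i + 3) - \<beta> i) * (\<beta> i ^ j i) ^ 2 = (\<beta> i ^ (2 * j i + 1)) ^ 3 - \<beta> i ^ (2 * j i + 1)"
      by (simp add: algebra_simps power_add power_mult power2_eq_square power3_eq_cube power_mult_distrib eval_nat_numeral)
    then show ?thesis
      unfolding Q_eq Affine_in_curve_points q_power(2)[OF that] A_eq[OF that] q_power(1)[OF that] .
  qed
  have two: "(2 :: 'a poly fract) \<noteq> 0"
  proof
    assume "(2 :: 'a poly fract) = 0"
    then have "to_fract (2 :: 'a poly) = 0"
      by (metis one_add_one to_fract_1 to_fract_add)
    then have two: "(2 :: 'a) = 0"
      by (simp add: numeral_poly)
    obtain l where "q = 2 * l + 1"
      using q_odd by (blast elim: oddE)
    then have "of_nat q = (1 :: 'a)"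
      using two by simp
    then show False
      using of_nat_choose_card_eq_0[of 1, where 'a = 'a] card_field_gt_1[where 'a = 'a] q(1) by simp
  qed
  interpret twisted_curve A
    by standard (use two A_nz in auto)
  interpret G: comm_group "mordell_weil A"
    by (rule comm_group_mordell_weil)
  have Q_in: "Q \<in> ?I \<rightarrow> carrier (mordell_weil A)"
    using Q_curve by (auto simp: mordell_weil_def)
  \<comment> \<open>The order of vanishing at a point \<open>\<theta>\<close> of the algebraic
    closure, extended to rational functions.\<close>
  define v where "v = (\<lambda>\<theta>. fract_ord (\<lambda>p. order \<theta> (ac_poly p :: 'a alg_closure poly)))"
  have ord_mult: "order \<theta> (ac_poly (p * r)) = order \<theta> (ac_poly p) + order \<theta> (ac_poly r)"
    if "p \<noteq> 0" "r \<noteq> 0" for p r :: "'a poly" and \<theta>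
    using that by (simp add: ac_poly_mult order_mult)
  have v: "int_valuation A (v \<theta>)" for \<theta>
    by standard (simp add: v_def fract_ord_mult[OF ord_mult])
  have v_frob: "v \<theta> (to_fract (frob_poly D)) = int (order \<theta> (ac_poly (frob_poly D)))" if "D \<noteq> 0" for D \<theta>
    unfolding v_def using degree_frob_poly[OF that] by (intro fract_ord_to_fract ord_mult) auto
  have v_odd: "odd (v \<theta> (to_fract (frob_poly D)))" if "D \<noteq> 0" "frob_act D \<theta> = 0" for D \<theta>
    using odd_order_frob_poly[OF _ that] q_odd v_frob[OF that(1)] q(1) by simp
  have v_0: "v \<theta> (to_fract (frob_poly D)) = 0" if "D \<noteq> 0" "frob_act D \<theta> \<noteq> 0" for D \<theta>
    using order_frob_poly_eq_0[OF that(2)] v_frob[OF that(1)] by simp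
  have monom_nz: "monom 1 (k i) - 1 \<noteq> (0 :: 'a poly)" if "i \<in> ?I" for i
    using A0_eq[OF that] A0_nz by auto

  \<comment> \<open>At \<open>\<theta>A\<close>, \<open>A\<close> has odd order while no
    \<open>\<beta> i\<close> vanishes: if \<open>B i\<close> killed \<open>\<theta>A\<close>, then
    \<open>t^(k i) - 1\<close> would divide 1.\<close>
  obtain \<theta>A where \<theta>A: "frob_act A0 \<theta>A = 0" "\<And>D. frob_act D \<theta>A = 0 \<Longrightarrow> \<exists>m. A0 dvd monom 1 m * D"
    using frob_act_annihilator[OF A0_nz] by blast
  have vA_odd: "odd (v \<theta>A A)"
    unfolding A_def using v_odd[OF A0_nz \<theta>A(1)] .
  have v\<beta>_0: "v \<theta>A (\<beta> i) = 0" if i: "i \<in> ?I" for i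
  proof -
    have "frob_act (B i) \<theta>A \<noteq> 0"
    proof
      assume "frob_act (B i) \<theta>A = 0"
      then obtain l where "(monom 1 (k i) - 1) * B i dvd monom 1 l * B i"
        using \<theta>A(2) A0_eq[OF i] by metis
      then have "monom 1 (k i) - 1 dvd monom 1 l * (1 :: 'a poly)"
        using B_nz[OF i] by simp
      then have "monom 1 (k i) - 1 dvd (1 :: 'a poly)"
        by (rule monom_minus_one_dvd_cancel[OF conjunct2[OF k(2)[OF i]]])
      then have "degree (monom 1 (k i) - 1 :: 'a poly) \<le> degree (1 :: 'a poly)"
        by (rule dvd_imp_degree_le) simp
      then show False
        using k(2)[OF i] by (simp add: degree_monom_minus_one)
    qed
    then show ?thesis
      unfolding \<beta>_def by (rule v_0[OF B_nz[OF i]])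
  qed

  have even: "even (c i0)"
    if tors: "(\<Otimes>\<^bsub>mordell_weil A\<^esub>i\<in>?I. Q i [^]\<^bsub>mordell_weil A\<^esub> c i) \<otimes>\<^bsub>mordell_weil A\<^esub>
      (\<Otimes>\<^bsub>mordell_weil A\<^esub>i\<in>?I. Q i [^]\<^bsub>mordell_weil A\<^esub> c i) = \<one>\<^bsub>mordell_weil A\<^esub>"
      and i0: "i0 \<in> ?I" for c :: "nat \<Rightarrow> int" and i0
  proof (rule ccontr)
    assume "odd (c i0)"
    define z where "z = (\<Otimes>\<^bsub>mordell_weil A\<^esub>i\<in>?I. Q i [^]\<^bsub>mordell_weil A\<^esub> c i)"
    have z_in: "z \<in> curve_points A"
    proof -
      have "z \<in> carrier (mordell_weil A)"
        unfolding z_def using Q_in by (intro G.finprod_closed) auto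
      then show ?thesis
        by (simp add: mordell_weil_def)
    qed
    have z_tors: "point_add A z z = Infinity"
      using tors unfolding z_def[symmetric] by (simp add: mordell_weil_def)
    \<comment> \<open>At \<open>e = 0\<close> the descent values of the 2-torsion points are
      \<open>1\<close>, \<open>-1\<close>, \<open>A\<close> and \<open>-A\<close>, so one
      \<open>\<epsilon>\<close>, equal to 0 or 1, serves all \<open>\<theta>\<close>.\<close>
    obtain \<epsilon> :: int where \<epsilon>: "\<And>\<theta>. v \<theta> (descent 0 z) = \<epsilon> * v \<theta> A"
    proof (rule two_torsion_cases[OF z_in z_tors])
      assume "z = Infinity"
      then show thesis
        using int_valuation.v_1[OF v] that[of 0] by (simp add: descent_def)
    next
      assume "z = Affine 0 0"
      then show thesis
        using int_valuation.v_minus_1[OF v] that[of 0] by (simp add: descent_def)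
    next
      assume "z = Affine 1 0"
      then show thesis
        using that[of 1] by (simp add: descent_def)
    next
      assume "z = Affine (- 1) 0"
      then have "descent 0 z = A * - 1"
        by (simp add: descent_def)
      then show thesis
        using that[of 1] A_nz int_valuation.v_mult[OF v, of A "- 1"] int_valuation.v_minus_1[OF v] by simp
    qed
    have v_Q: "v \<theta> (descent 0 (Q i)) = v \<theta> A + int (m i) * v \<theta> (\<beta> i)" if "i \<in> ?I" for \<theta> i
    proof -
      have "descent 0 (Q i) = A * \<beta> i ^ m i"
        using \<beta>_nz[OF that] by (simp add: Q_eq descent_def)
      then show ?thesis
        using \<beta>_nz[OF that] A_nz int_valuation.v_mult[OF v, of A "\<beta> i ^ m i"]
          int_valuation.v_power[OF v, where x = "\<beta> i" and n = "m i"] by simp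
    qed
    have parity: "even (\<epsilon> * v \<theta> A + (\<Sum>i\<in>?I. c i * (v \<theta> A + int (m i) * v \<theta> (\<beta> i))))" for \<theta>
    proof -
      have "even (v \<theta> (descent 0 z) + (\<Sum>i\<in>?I. c i * v \<theta> (descent 0 (Q i))))"
        unfolding z_def
        using int_valuation.even_v_descent_add[OF v, of 0] Q_in
        by (intro G.even_finprod) (simp_all add: mordell_weil_def add.assoc)
      then show ?thesis
        by (simp add: \<epsilon> v_Q)
    qed
    have parity': "even ((\<epsilon> + (\<Sum>i\<in>?I. c i)) * v \<theta> A + (\<Sum>i\<in>?I. c i * int (m i) * v \<theta> (\<beta> i)))" for \<theta>
    proof -
      have "(\<Sum>i\<in>?I. c i * (v \<theta> A + int (m i) * v \<theta> (\<beta> i))) =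
          (\<Sum>i\<in>?I. c i) * v \<theta> A + (\<Sum>i\<in>?I. c i * int (m i) * v \<theta> (\<beta> i))"
        by (simp add: sum_distrib_right distrib_left sum.distrib mult.assoc)
      then show ?thesis
        using parity[of \<theta>] by (simp only: distrib_right add.assoc)
    qed
    have "(\<Sum>i\<in>?I. c i * int (m i) * v \<theta>A (\<beta> i)) = 0"
      using v\<beta>_0 by (intro sum.neutral) simp
    then have \<epsilon>_even: "even (\<epsilon> + (\<Sum>i\<in>?I. c i))"
      using parity'[of \<theta>A] vA_odd by simp
    have sum_even: "even (\<Sum>i\<in>?I. c i * int (m i) * v \<theta> (\<beta> i))" for \<theta>
      using parity'[of \<theta>] \<epsilon>_even by simp
    \<comment> \<open>Since \<open>A0 = (t^(k i) - 1) B i\<close>, a minimal \<open>k i\<close>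
      means a \<open>B i\<close> of largest degree; this keeps the other \<open>B i\<close> with odd
      coefficient from killing a point with annihilator \<open>B i1\<close>.\<close>
    define i1 where "i1 = arg_min k (\<lambda>i. i \<in> ?I \<and> odd (c i))"
    have i1: "i1 \<in> ?I" "odd (c i1)" and i1_min: "\<And>i. i \<in> ?I \<Longrightarrow> odd (c i) \<Longrightarrow> k i1 \<le> k i"
      using arg_min_nat_lemma[of "\<lambda>i. i \<in> ?I \<and> odd (c i)" i0 k] i0 \<open>odd (c i0)\<close>
      by (auto simp: i1_def)
    obtain \<theta> where \<theta>: "frob_act (B i1) \<theta> = 0" "\<And>D. frob_act D \<theta> = 0 \<Longrightarrow> \<exists>m. B i1 dvd monom 1 m * D"
      using frob_act_annihilator[OF B_nz[OF i1(1)]] by blast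
    have others: "v \<theta> (\<beta> i) = 0" if i: "i \<in> ?I" "odd (c i)" "i \<noteq> i1" for i
    proof -
      have "frob_act (B i) \<theta> \<noteq> 0"
      proof
        assume "frob_act (B i) \<theta> = 0"
        then obtain l where "B i1 dvd monom 1 l * B i"
          using \<theta>(2) by blast
        \<comment> \<open>Both \<open>B i\<close> and \<open>B i1\<close> are cofactors in
          \<open>A0\<close>, so the divisibility is reversed into one between
          \<open>t^(k i) - 1\<close> and \<open>t^(k i1) - 1\<close>.\<close>
        then have "(monom 1 (k i) - 1) * B i1 dvd (monom 1 (k i) - 1) * (monom 1 l * B i)"
          by (rule mult_dvd_mono[OF dvd_refl])
        also have "\<dots> = monom 1 l * ((monom 1 (k i1) - 1) * B i1)"
          using A0_eq[OF i(1)] A0_eq[OF i1(1)] by (simp only: mult.left_commute)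
        finally have "monom 1 (k i) - 1 dvd monom 1 l * (monom 1 (k i1) - 1 :: 'a poly)"
          using B_nz[OF i1(1)] by (simp flip: mult.assoc)
        then have "monom 1 (k i) - 1 dvd (monom 1 (k i1) - 1 :: 'a poly)"
          by (rule monom_minus_one_dvd_cancel[OF conjunct2[OF k(2)[OF i(1)]]])
        then have "degree (monom 1 (k i) - 1 :: 'a poly) \<le> degree (monom 1 (k i1) - 1 :: 'a poly)"
          using monom_nz[OF i1(1)] by (rule dvd_imp_degree_le)
        then have "k i \<le> k i1"
          using k(2)[OF i(1)] k(2)[OF i1(1)] by (simp add: degree_monom_minus_one)
        then have "k i = k i1"
          using i1_min[OF i(1,2)] by simp
        then show False
          using k(1) i(1,3) i1(1) by (auto dest: inj_onD)
      qed
      then show ?thesis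
        unfolding \<beta>_def by (rule v_0[OF B_nz[OF i(1)]])
    qed
    \<comment> \<open>The other terms are even, through \<open>c i\<close> or because the valuation
      is 0; the term of \<open>i1\<close> is a product of three odd numbers.\<close>
    have "(\<Sum>i\<in>?I. c i * int (m i) * v \<theta> (\<beta> i)) = c i1 * int (m i1) * v \<theta> (\<beta> i1) +
        (\<Sum>i\<in>?I - {i1}. c i * int (m i) * v \<theta> (\<beta> i))"
      using i1(1) by (intro sum.remove) auto
    moreover have "even (\<Sum>i\<in>?I - {i1}. c i * int (m i) * v \<theta> (\<beta> i))"
      using others by (intro dvd_sum) auto
    moreover have "odd (c i1 * int (m i1) * v \<theta> (\<beta> i1))"
      using i1 q_power(2)[OF i1(1)] v_odd[OF B_nz[OF i1(1)] \<theta>(1)] by (simp add: \<beta>_def)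
    ultimately show False
      using sum_even[of \<theta>] by simp
  qed
  have "int_lin_indep (mordell_weil A) ?I Q"
  proof (rule G.int_lin_indep_by_descent[OF _ Q_in])
    show "even (c i)"
      if "(\<Otimes>\<^bsub>mordell_weil A\<^esub>i\<in>?I. Q i [^]\<^bsub>mordell_weil A\<^esub> c i) \<otimes>\<^bsub>mordell_weil A\<^esub>
        (\<Otimes>\<^bsub>mordell_weil A\<^esub>i\<in>?I. Q i [^]\<^bsub>mordell_weil A\<^esub> c i) = \<one>\<^bsub>mordell_weil A\<^esub>" "i \<in> ?I"
      for c :: "nat \<Rightarrow> int" and i
      using that by (rule even)
    show "x \<otimes>\<^bsub>mordell_weil A\<^esub> x = \<one>\<^bsub>mordell_weil A\<^esub>"
      if "x \<in> carrier (mordell_weil A)"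
        "x \<otimes>\<^bsub>mordell_weil A\<^esub> x \<otimes>\<^bsub>mordell_weil A\<^esub> (x \<otimes>\<^bsub>mordell_weil A\<^esub> x) = \<one>\<^bsub>mordell_weil A\<^esub>" for x
      using int_valuation.double_two_torsion_eq_Infinity[OF v vA_odd] that by (simp add: mordell_weil_def)
  qed simp
  then show ?thesis
    using Q_in by auto
qed

end
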